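(* For every nonempty graph $H$ (i.e. $H$ has at least one edge), $f(H,P_5)\leq R_{\chi(H)+1}(H)$.
   Context: $P_5$ is the path on $5$ vertices and $\chi(H)$ is the chromatic number of $H$. An edge-colored graph is monochromatic if all its edges have the same color and rainbow if all its edges have distinct colors. For graphs $H,G$, the constrained Ramsey number $f(H,G)$ is the minimum integer $n$ such that every edge-coloring of $K_n$ with any number of colors (colorings need not be proper) contains a monochromatic copy of $H$ or a rainbow copy of $G$. For a positive integer $k$, the $k$-colored Ramsey number $R_k(H)$ is the minimum integer $n$ such that every coloring of the edges of $K_n$ with colors from $\{1,\dots,k\}$ (not all colors need be used) contains a monochromatic copy of $H$. *)

theory Defs
  imports Main "HOL-Library.Ramsey"
begin

type_synonym 'a graph = "'a set \<times> 'a set set"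

abbreviation verts :: "'a graph \<Rightarrow> 'a set" where
  "verts \<equiv> fst"

abbreviation edges :: "'a graph \<Rightarrow> 'a set set" where
  "edges \<equiv> snd"

definition finite_graph :: "'a graph \<Rightarrow> bool" where
  "finite_graph G \<longleftrightarrow> finite (verts G) \<and> edges G \<subseteq> [verts G]\<^bsup>2\<^esup>"

definition complete_graph :: "nat \<Rightarrow> nat graph" where
  "complete_graph n = ({..<n}, [{..<n}]\<^bsup>2\<^esup>)"

text \<open>The argument of \<open>path_graph\<close> is the number of vertices, not the number of edges.\<close>

definition path_graph :: "nat \<Rightarrow> nat graph" where
  "path_graph n = ({..<n}, {{i, Suc i} | i. Suc i < n})"

definition subgraph :: "'a graph \<Rightarrow> 'a graph \<Rightarrow> bool" where
  "subgraph K G \<longleftrightarrow> verts K \<subseteq> verts G \<and> edges K \<subseteq> edges G \<and> edges K \<subseteq> [verts K]\<^bsup>2\<^esup>"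

definition graph_iso :: "'a graph \<Rightarrow> 'b graph \<Rightarrow> bool" where
  "graph_iso H K \<longleftrightarrow>
     (\<exists>\<phi>. bij_betw \<phi> (verts H) (verts K) \<and> edges K = (\<lambda>e. \<phi> ` e) ` edges H)"

definition is_copy_in :: "'b graph \<Rightarrow> 'a graph \<Rightarrow> 'b graph \<Rightarrow> bool" where
  "is_copy_in K H G \<longleftrightarrow> subgraph K G \<and> graph_iso H K"

definition proper_vertex_coloring :: "'a graph \<Rightarrow> nat \<Rightarrow> ('a \<Rightarrow> nat) \<Rightarrow> bool" where
  "proper_vertex_coloring G k c \<longleftrightarrow>
     c \<in> verts G \<rightarrow> {..<k} \<and>
     (\<forall>u\<in>verts G. \<forall>v\<in>verts G. {u, v} \<in> edges G \<longrightarrow> c u \<noteq> c v)"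

definition chromatic_number :: "'a graph \<Rightarrow> nat" where
  "chromatic_number G = (LEAST k. \<exists>c. proper_vertex_coloring G k c)"

definition monochromatic_graph :: "('a set \<Rightarrow> nat) \<Rightarrow> 'a graph \<Rightarrow> bool" where
  "monochromatic_graph c K \<longleftrightarrow> (\<forall>e\<in>edges K. \<forall>e'\<in>edges K. c e = c e')"

definition rainbow_graph :: "('a set \<Rightarrow> nat) \<Rightarrow> 'a graph \<Rightarrow> bool" where
  "rainbow_graph c K \<longleftrightarrow> inj_on c (edges K)"

text \<open>Colors range over all of \<open>nat\<close>. As complete graphs on \<open>n\<close> vertices have finitely many
  edges, this covers edge-colorings with any number of colors.\<close>

definition constrained_ramsey :: "'a graph \<Rightarrow> 'b graph \<Rightarrow> nat" where
  "constrained_ramsey H G =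
     (LEAST n. \<forall>c :: nat set \<Rightarrow> nat.
        (\<exists>K. is_copy_in K H (complete_graph n) \<and> monochromatic_graph c K) \<or>
        (\<exists>K. is_copy_in K G (complete_graph n) \<and> rainbow_graph c K))"

definition ramsey_number :: "nat \<Rightarrow> 'a graph \<Rightarrow> nat" where
  "ramsey_number k H =
     (LEAST n. \<forall>c \<in> edges (complete_graph n) \<rightarrow> {1..k}.
        \<exists>K. is_copy_in K H (complete_graph n) \<and> monochromatic_graph c K)"

end

theory Submission
  imports Defs
begin

text \<open>
  Let \<open>k = \<chi>(H)\<close> and \<open>N = R\<^bsub>k+1\<^esub>(H)\<close>. A colouring of \<open>K\<^sub>N\<close> with at most \<open>k + 1\<close> colours contains a
  monochromatic \<open>H\<close> by the choice of \<open>N\<close>, so consider one with at least four colours and no rainbow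
  \<open>P\<^sub>5\<close>. For \<open>N \<ge> 6\<close> it has one of three shapes (a result of Thomason and Wagner, up to details):
  apart from the edges at one vertex and one further edge all edges have the same colour; apart from
  the edges inside a set of four vertices all edges have the same colour; or some colour is dominant,
  that is, any two incident edges of other colours have equal colours.

  Applied to suitable colourings with \<open>k + 1\<close> colours, the Ramsey property also limits \<open>H\<close>: without
  its isolated vertices, \<open>H\<close> has fewer than \<open>N\<close> vertices; it is a star or has at most \<open>N - 2\<close> vertices;
  and it is a star or embeds into \<open>K\<^sub>N\<close> without using an edge inside four given vertices. This settles
  the first two cases, and \<open>N \<le> 5\<close>, where only tiny stars are left.

  If a colour is dominant, the other colour classes live on disjoint vertex sets. These are merged
  into blocks as long as two blocks together have fewer vertices than \<open>H\<close>. If at most \<open>k\<close> blocks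
  remain, one colour per block suffices and the Ramsey property applies. Otherwise the blocks are so
  large that a \<open>k\<close>-colouring of \<open>H\<close> embeds \<open>H\<close> into the complete multipartite graph between them.
\<close>

section \<open>Colourings without a rainbow \<open>P\<^sub>5\<close>\<close>

locale rainbow_P5_free =
  fixes V :: "'v set" and f :: "'v \<Rightarrow> 'v \<Rightarrow> 'c"
  assumes card_V: "5 \<le> card V"
    and sym: "f x y = f y x"
    and no_rainbow: "{a, b, c, d, e} \<subseteq> V \<Longrightarrow> distinct [a, b, c, d, e] \<Longrightarrow>
      \<not> distinct [f a b, f b c, f c d, f d e]"
begin

section \<open>Four-coloured patterns on four or five vertices\<close>

text \<open>The colour of \<open>a e\<close> is left open, so \<open>e\<close> is only a sample of
  the vertices outside \<open>a\<close>, \<open>b\<close>, \<open>c\<close>, \<open>d\<close>; this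
  is what lets \<open>e\<close> be exchanged for any further vertex.\<close>

definition apex_type where
  "apex_type a b c d e \<longleftrightarrow> {a, b, c, d, e} \<subseteq> V \<and> distinct [a, b, c, d, e] \<and>
     distinct [f a b, f a c, f a d, f b c] \<and>
     f b d = f b c \<and> f b e = f b c \<and> f c d = f b c \<and> f c e = f b c \<and> f d e = f b c"

definition triangle_type where
  "triangle_type a b c d \<longleftrightarrow> {a, b, c, d} \<subseteq> V \<and> distinct [a, b, c, d] \<and>
     distinct [f a b, f b c, f a c, f a d] \<and> f b d = f a d \<and> f c d = f a d"

text \<open>Removing \<open>a\<close> and the edge \<open>b c\<close> leaves only the colour of
  \<open>d e\<close>, which prepares \<open>near_monochromatic\<close>.\<close>

definition tailed_triangle_type where
  "tailed_triangle_type a b c d e \<longleftrightarrow> {a, b, c, d, e} \<subseteq> V \<and> distinct [a, b, c, d, e] \<and>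
     distinct [f a b, f b c, f a c, f d e] \<and> f a d = f b c \<and> f a e = f b c \<and>
     f b d = f d e \<and> f b e = f d e \<and> f c d = f d e \<and> f c e = f d e"

text \<open>Each triangle vertex sees \<open>d\<close> and \<open>e\<close> in the colour of the
  opposite triangle edge. The pattern cannot be extended, so it occurs only on exactly five
  vertices.\<close>

definition sporadic_type where
  "sporadic_type a b c d e \<longleftrightarrow> {a, b, c, d, e} \<subseteq> V \<and> distinct [a, b, c, d, e] \<and>
     distinct [f a b, f b c, f a c, f d e] \<and> f a d = f b c \<and> f a e = f b c \<and>
     f b d = f a c \<and> f b e = f a c \<and> f c d = f a b \<and> f c e = f a b"

definition structured :: bool where
  "structured \<longleftrightarrow> (\<exists>a b c d e. apex_type a b c d e \<or> triangle_type a b c d \<or>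
     tailed_triangle_type a b c d e \<or> sporadic_type a b c d e)"

text \<open>Each of the 5!/2 = 60 Hamiltonian paths on the five vertices appears once, so that the
  finite case analyses below need no instantiation.\<close>

lemma no_rainbow_five:
  assumes "{a, b, c, d, e} \<subseteq> V" "distinct [a, b, c, d, e]"
  shows
   "\<not> distinct [f a b, f b c, f c d, f d e] \<and> \<not> distinct [f a b, f b c, f c e, f e d] \<and>
     \<not> distinct [f a b, f b d, f d c, f c e] \<and> \<not> distinct [f a b, f b d, f d e, f e c] \<and>
     \<not> distinct [f a b, f b e, f e c, f c d] \<and> \<not> distinct [f a b, f b e, f e d, f d c] \<and>
     \<not> distinct [f a c, f c b, f b d, f d e] \<and> \<not> distinct [f a c, f c b, f b e, f e d] \<and>
     \<not> distinct [f a c, f c d, f d b, f b e] \<and> \<not> distinct [f a c, f c d, f d e, f e b] \<and>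
     \<not> distinct [f a c, f c e, f e b, f b d] \<and> \<not> distinct [f a c, f c e, f e d, f d b] \<and>
     \<not> distinct [f a d, f d b, f b c, f c e] \<and> \<not> distinct [f a d, f d b, f b e, f e c] \<and>
     \<not> distinct [f a d, f d c, f c b, f b e] \<and> \<not> distinct [f a d, f d c, f c e, f e b] \<and>
     \<not> distinct [f a d, f d e, f e b, f b c] \<and> \<not> distinct [f a d, f d e, f e c, f c b] \<and>
     \<not> distinct [f a e, f e b, f b c, f c d] \<and> \<not> distinct [f a e, f e b, f b d, f d c] \<and>
     \<not> distinct [f a e, f e c, f c b, f b d] \<and> \<not> distinct [f a e, f e c, f c d, f d b] \<and>
     \<not> distinct [f a e, f e d, f d b, f b c] \<and> \<not> distinct [f a e, f e d, f d c, f c b] \<and>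
     \<not> distinct [f b a, f a c, f c d, f d e] \<and> \<not> distinct [f b a, f a c, f c e, f e d] \<and>
     \<not> distinct [f b a, f a d, f d c, f c e] \<and> \<not> distinct [f b a, f a d, f d e, f e c] \<and>
     \<not> distinct [f b a, f a e, f e c, f c d] \<and> \<not> distinct [f b a, f a e, f e d, f d c] \<and>
     \<not> distinct [f b c, f c a, f a d, f d e] \<and> \<not> distinct [f b c, f c a, f a e, f e d] \<and>
     \<not> distinct [f b c, f c d, f d a, f a e] \<and> \<not> distinct [f b c, f c e, f e a, f a d] \<and>
     \<not> distinct [f b d, f d a, f a c, f c e] \<and> \<not> distinct [f b d, f d a, f a e, f e c] \<and>
     \<not> distinct [f b d, f d c, f c a, f a e] \<and> \<not> distinct [f b d, f d e, f e a, f a c] \<and>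
     \<not> distinct [f b e, f e a, f a c, f c d] \<and> \<not> distinct [f b e, f e a, f a d, f d c] \<and>
     \<not> distinct [f b e, f e c, f c a, f a d] \<and> \<not> distinct [f b e, f e d, f d a, f a c] \<and>
     \<not> distinct [f c a, f a b, f b d, f d e] \<and> \<not> distinct [f c a, f a b, f b e, f e d] \<and>
     \<not> distinct [f c a, f a d, f d b, f b e] \<and> \<not> distinct [f c a, f a e, f e b, f b d] \<and>
     \<not> distinct [f c b, f b a, f a d, f d e] \<and> \<not> distinct [f c b, f b a, f a e, f e d] \<and>
     \<not> distinct [f c b, f b d, f d a, f a e] \<and> \<not> distinct [f c b, f b e, f e a, f a d] \<and>
     \<not> distinct [f c d, f d a, f a b, f b e] \<and> \<not> distinct [f c d, f d b, f b a, f a e] \<and>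
     \<not> distinct [f c e, f e a, f a b, f b d] \<and> \<not> distinct [f c e, f e b, f b a, f a d] \<and>
     \<not> distinct [f d a, f a b, f b c, f c e] \<and> \<not> distinct [f d a, f a c, f c b, f b e] \<and>
     \<not> distinct [f d b, f b a, f a c, f c e] \<and> \<not> distinct [f d b, f b c, f c a, f a e] \<and>
     \<not> distinct [f d c, f c a, f a b, f b e] \<and> \<not> distinct [f d c, f c b, f b a, f a e]"
  by (intro conjI no_rainbow) (use assms in auto)

section \<open>Rainbow subgraphs with four edges\<close>

text \<open>A connected graph with four edges other than \<open>P\<^sub>5\<close> is a star, a
  chair, a paw or a four-cycle. For each of these, and for a triangle with a disjoint edge, the
  sixty paths on five vertices leave only the four patterns. Each of the five lemmas lists candidate
  relabellings, which makes the claim quantifier-free for the solver; the instances of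
  \<open>sym\<close> bring every edge into one orientation.\<close>

lemma rainbow_star4:
  assumes V: "{a, b, c, d, e} \<subseteq> V" "distinct [a, b, c, d, e]"
    and col: "distinct [f a b, f a c, f a d, f a e]"
  shows structured
proof -
  have "triangle_type a b c d \<or> triangle_type a b c e \<or> triangle_type a b d c \<or>
    triangle_type a c d b \<or> apex_type a b c d e \<or> triangle_type a b d e \<or>
    triangle_type a b e c \<or> triangle_type a b e d \<or> triangle_type a c e b \<or>
    apex_type a b c e d \<or> apex_type a b d e c \<or> apex_type a c d e b \<or>
    triangle_type a c d e \<or> triangle_type a c e d \<or> triangle_type a d e b \<or>
    triangle_type a d e c \<or> sporadic_type b c d a e \<or> sporadic_type b c e a d \<or>
    sporadic_type b d e a c \<or> sporadic_type c d e a b"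
    using no_rainbow_five[OF V] col V(2)
    unfolding apex_type_def triangle_type_def tailed_triangle_type_def sporadic_type_def
      sym[of b a] sym[of c a] sym[of d a] sym[of e a] sym[of c b] sym[of d b] sym[of e b]
      sym[of d c] sym[of e c] sym[of e d] distinct.simps list.set insert_iff empty_iff
    using V(1) by (smt (verit) insert_subset)
  then show ?thesis
    unfolding structured_def by blast
qed

lemma rainbow_chair:
  assumes V: "{a, b, c, d, e} \<subseteq> V" "distinct [a, b, c, d, e]"
    and col: "distinct [f a b, f a c, f a d, f d e]"
  shows structured
proof -
  have "apex_type a b c d e \<or> triangle_type a b c e \<or> triangle_type a b d e \<or>
    tailed_triangle_type a b c d e \<or> sporadic_type a b c d e \<or> tailed_triangle_type a b d c e \<or>
    tailed_triangle_type a c d b e \<or> triangle_type a c d e \<or> sporadic_type b c e a d"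
    using no_rainbow_five[OF V] col V(2)
    unfolding apex_type_def triangle_type_def tailed_triangle_type_def sporadic_type_def
      sym[of b a] sym[of c a] sym[of d a] sym[of e a] sym[of c b] sym[of d b] sym[of e b]
      sym[of d c] sym[of e c] sym[of e d] distinct.simps list.set insert_iff empty_iff
    using V(1) by (smt (verit) insert_subset)
  then show ?thesis
    unfolding structured_def by blast
qed

lemma rainbow_paw:
  assumes V: "{a, b, c, d, e} \<subseteq> V" "distinct [a, b, c, d, e]"
    and col: "distinct [f a b, f b c, f a c, f a d]"
  shows structured
proof -
  have "triangle_type a b c d \<or> apex_type a b c d e \<or> triangle_type a b c e \<or>
    triangle_type a b d e \<or> tailed_triangle_type a b d c e \<or> tailed_triangle_type a c d b e \<or>
    triangle_type a c d e \<or> tailed_triangle_type b a c d e \<or> sporadic_type b c e a d \<or>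
    tailed_triangle_type c a b d e"
    using no_rainbow_five[OF V] col V(2)
    unfolding apex_type_def triangle_type_def tailed_triangle_type_def sporadic_type_def
      sym[of b a] sym[of c a] sym[of d a] sym[of e a] sym[of c b] sym[of d b] sym[of e b]
      sym[of d c] sym[of e c] sym[of e d] distinct.simps list.set insert_iff empty_iff
    using V(1) by (smt (verit) insert_subset)
  then show ?thesis
    unfolding structured_def by blast
qed

lemma rainbow_C4:
  assumes V: "{a, b, c, d, e} \<subseteq> V" "distinct [a, b, c, d, e]"
    and col: "distinct [f a b, f b c, f c d, f a d]"
  shows structured
proof -
  have "sporadic_type a b e c d \<or> sporadic_type a d e b c \<or> sporadic_type b c e a d \<or>
    sporadic_type c d e a b"
    using no_rainbow_five[OF V] col V(2)
    unfolding apex_type_def triangle_type_def tailed_triangle_type_def sporadic_type_def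
      sym[of b a] sym[of c a] sym[of d a] sym[of e a] sym[of c b] sym[of d b] sym[of e b]
      sym[of d c] sym[of e c] sym[of e d] distinct.simps list.set insert_iff empty_iff
    using V(1) by (smt (verit) insert_subset)
  then show ?thesis
    unfolding structured_def by blast
qed

lemma rainbow_triangle_plus_edge:
  assumes V: "{a, b, c, d, e} \<subseteq> V" "distinct [a, b, c, d, e]"
    and col: "distinct [f a b, f b c, f a c, f d e]"
  shows structured
proof -
  have "triangle_type a b c d \<or> triangle_type a b c e \<or> tailed_triangle_type a b c d e \<or>
    sporadic_type a b c d e \<or> tailed_triangle_type b a c d e \<or> tailed_triangle_type c a b d e"
    using no_rainbow_five[OF V] col V(2)
    unfolding apex_type_def triangle_type_def tailed_triangle_type_def sporadic_type_def
      sym[of b a] sym[of c a] sym[of d a] sym[of e a] sym[of c b] sym[of d b] sym[of e b]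
      sym[of d c] sym[of e c] sym[of e d] distinct.simps list.set insert_iff empty_iff
    using V(1) by (smt (verit) insert_subset)
  then show ?thesis
    unfolding structured_def by blast
qed

text \<open>This six-vertex pattern is the source of the dominant colour \<open>f a b\<close>. The
  three pairs play symmetric roles.\<close>

definition matching_type where
  "matching_type a a' b b' c c' \<longleftrightarrow> {a, a', b, b', c, c'} \<subseteq> V \<and> distinct [a, a', b, b', c, c'] \<and>
     distinct [f a a', f b b', f c c', f a b] \<and>
     (\<forall>x\<in>{a, a'}. \<forall>y\<in>{b, b', c, c'}. f x y = f a b) \<and>
     (\<forall>x\<in>{b, b'}. \<forall>y\<in>{c, c'}. f x y = f a b)"

lemma ex_fifth_vertex:
  obtains e where "e \<in> V" "e \<notin> {a, b, c, d}"
proof -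
  have "card {a, b, c, d} \<le> 4"
    using card_length[of "[a, b, c, d]"] by simp
  then have "\<not> V \<subseteq> {a, b, c, d}"
    using card_V card_mono[of "{a, b, c, d}" V] by auto
  then show ?thesis
    using that by blast
qed

lemma rainbow_paw_four:
  assumes "{a, b, c, d} \<subseteq> V" "distinct [a, b, c, d]" "distinct [f a b, f b c, f a c, f a d]"
  shows structured
proof -
  obtain e where "e \<in> V" "e \<notin> {a, b, c, d}"
    by (rule ex_fifth_vertex)
  then show ?thesis
    using assms by (intro rainbow_paw[of a b c d e]) auto
qed

lemma rainbow_C4_four:
  assumes "{a, b, c, d} \<subseteq> V" "distinct [a, b, c, d]" "distinct [f a b, f b c, f c d, f a d]"
  shows structured
proof -
  obtain e where "e \<in> V" "e \<notin> {a, b, c, d}"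
    by (rule ex_fifth_vertex)
  then show ?thesis
    using assms by (intro rainbow_C4[of a b c d e]) auto
qed

section \<open>Adding an edge of a fourth colour\<close>

text \<open>A crossing edge is oriented so that \<open>u\<close> lies in \<open>A\<close>; hence the
  equation between colours instead of endpoints.\<close>

lemma edge_position:
  assumes "x \<in> V" "y \<in> V"
  obtains (inside) "x \<in> A" "y \<in> A"
    | (crossing) u z where "u \<in> A" "z \<in> V" "z \<notin> A" "f u z = f x y"
    | (disjoint) "x \<notin> A" "y \<notin> A"
  using assms sym[of x y] by metis

text \<open>An edge of the fourth colour inside the star completes a paw; one that leaves it
  completes a larger star or a chair.\<close>

lemma rainbow_star3_and_fourth_color:
  assumes V: "{p, a, b, c, x, y} \<subseteq> V" "distinct [p, a, b, c]" "x \<noteq> y"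
    and col: "distinct [f p a, f p b, f p c, f x y]"
  shows structured
proof -
  have xy: "x \<in> V" "y \<in> V"
    using V by auto
  then show ?thesis
  proof (cases rule: edge_position[where A = "{p, a, b, c}"])
    case inside
    then have "f a b = f x y \<or> f a c = f x y \<or> f b c = f x y"
      using V(3) col sym by auto
    then show ?thesis
      using rainbow_paw_four[of p a b c] rainbow_paw_four[of p a c b] rainbow_paw_four[of p b c a]
        V col by auto
  next
    case (crossing u z)
    then show ?thesis
      using rainbow_star4[of p a b c z] rainbow_chair[of p a b c z] rainbow_chair[of p a c b z]
        rainbow_chair[of p b c a z] V col by auto
  next
    case disjoint
    \<comment> \<open>Either \<open>p x\<close> repeats a colour of the star and replaces that edge
      in a chair ending with \<open>x y\<close>, or it is a fourth ray of a rainbow star.\<close>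
    show ?thesis
    proof (cases "f p x \<in> {f p a, f p b, f p c}")
      case True
      then show ?thesis
        using rainbow_chair[of p a b x y] rainbow_chair[of p a c x y] rainbow_chair[of p b c x y]
          V col disjoint by auto
    next
      case False
      then show ?thesis
        using rainbow_star4[of p a b c x] V col disjoint by auto
    qed
  qed
qed

lemma rainbow_triangle_and_fourth_color:
  assumes V: "{a, b, c, x, y} \<subseteq> V" "distinct [a, b, c]" "x \<noteq> y"
    and col: "distinct [f a b, f b c, f a c, f x y]"
  shows structured
proof -
  have xy: "x \<in> V" "y \<in> V"
    using V by auto
  then show ?thesis
  proof (cases rule: edge_position[where A = "{a, b, c}"])
    case inside
    then show ?thesis
      using V(3) col sym by auto
  next
    case (crossing u z)
    then show ?thesis
      using rainbow_paw_four[of a b c z] rainbow_paw_four[of b a c z] rainbow_paw_four[of c a b z]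
        sym[of b a] sym[of c a] sym[of c b] V col by auto
  next
    case disjoint
    then show ?thesis
      using rainbow_triangle_plus_edge[of a b c x y] V col by auto
  qed
qed

text \<open>The middle colour of the path dominates: any other colour on an edge between the path and
  the disjoint edge produces a rainbow \<open>P\<^sub>5\<close> or a connected rainbow graph with four edges.\<close>

lemma rainbow_P4_disjoint_edge:
  assumes V: "{a, b, c, d, x, y} \<subseteq> V" "distinct [a, b, c, d, x, y]"
    and col: "distinct [f a b, f b c, f c d, f x y]"
    and "\<not> structured"
  shows "f b x = f b c" "f a x = f b c"
proof -
  show bx: "f b x = f b c"
  proof (rule ccontr)
    assume "f b x \<noteq> f b c"
    then consider "f b x = f a b" | "f b x = f c d" | "f b x \<notin> {f a b, f b c, f c d}"
      by auto
    then show False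
    proof cases
      case 1
      then show False
        using no_rainbow[of d c b x y] sym[of d c] sym[of c b] V col by auto
    next
      case 2
      then show False
        using rainbow_chair[of b a c x y] sym[of b a] V col \<open>\<not> structured\<close> by auto
    next
      case 3
      then show False
        using rainbow_chair[of b a x c d] sym[of b a] V col \<open>\<not> structured\<close> by auto
    qed
  qed
  show "f a x = f b c"
  proof (rule ccontr)
    assume "f a x \<noteq> f b c"
    then consider "f a x = f a b" | "f a x = f c d" | "f a x \<notin> {f a b, f b c, f c d}"
      by auto
    then show False
    proof cases
      case 1
      then show False
        using rainbow_star3_and_fourth_color[of x a b y c d] sym[of x a] sym[of x b] bx V col
          \<open>\<not> structured\<close> by auto
    next
      case 2
      then show False
        using no_rainbow[of c b a x y] sym[of b a] sym[of c b] V col by auto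
    next
      case 3
      then show False
        using no_rainbow[of x a b c d] sym[of x a] V col by auto
    qed
  qed
qed

text \<open>Inside the vertex set of the path the fourth colour completes a paw or a four-cycle; an
  edge leaving that set gives a chair or a rainbow \<open>P\<^sub>5\<close>. Only a disjoint edge
  allows the matching pattern.\<close>

lemma rainbow_P4_and_fourth_color:
  assumes V: "{a, b, c, d, x, y} \<subseteq> V" "distinct [a, b, c, d]" "x \<noteq> y"
    and col: "distinct [f a b, f b c, f c d, f x y]"
  shows "structured \<or> matching_type a b c d x y"
proof -
  have xy: "x \<in> V" "y \<in> V"
    using V by auto
  then show ?thesis
  proof (cases rule: edge_position[where A = "{a, b, c, d}"])
    case inside
    then have "f a c = f x y \<or> f b d = f x y \<or> f a d = f x y"
      using V(3) col sym by auto
    then show ?thesis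
      using rainbow_paw_four[of c a b d] rainbow_paw_four[of b c d a] rainbow_C4_four[of a b c d]
        sym[of c a] sym[of c b] sym[of b a] V col by auto
  next
    case (crossing u z)
    then show ?thesis
      using no_rainbow[of z a b c d] no_rainbow[of a b c d z] rainbow_chair[of b a z c d]
        rainbow_chair[of c d z b a] sym[of z a] sym[of b a] sym[of c b] sym[of d c] V col by auto
  next
    case disjoint
    have "matching_type a b c d x y" if "\<not> structured"
    proof -
      note P = rainbow_P4_disjoint_edge[OF _ _ _ that]
      have 1: "f b x = f b c" "f a x = f b c"
        using P[of a b c d x y] V col disjoint by auto
      have 2: "f b y = f b c" "f a y = f b c"
        using P[of a b c d y x] sym[of y x] V col disjoint by auto
      have 3: "f c x = f b c" "f d x = f b c"
        using P[of d c b a x y] sym[of b a] sym[of c b] sym[of d c] V col disjoint by auto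
      have 4: "f c y = f b c" "f d y = f b c"
        using P[of d c b a y x] sym[of b a] sym[of c b] sym[of d c] sym[of y x] V col disjoint by auto
      \<comment> \<open>The edges between \<open>a b\<close> and \<open>c d\<close> are reached by
        the path \<open>a b x y\<close> with the disjoint edge \<open>c d\<close>; by
        \<open>1\<close> its middle edge has the same colour.\<close>
      have 5: "f a c = f b c" "f b d = f b c" "f a d = f b c"
        using P[of a b x y c d] P[of a b x y d c] sym[of d c] 1 V col disjoint by auto
      show ?thesis
        unfolding matching_type_def using 1 2 3 4 5 V col disjoint by auto
    qed
    then show ?thesis
      by blast
  qed
qed

text \<open>A rainbow subgraph is grown edge by edge: two incident edges of different colours, then
  with a third colour a star, a path or a triangle, then a fourth colour. Hypothesis
  \<open>many\<close> encodes that at least four colours occur.\<close>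

lemma structured_or_matching_type:
  assumes many: "\<And>i j k. \<exists>x\<in>V. \<exists>y\<in>V. x \<noteq> y \<and> f x y \<notin> {i, j, k}"
  shows "structured \<or> (\<exists>a a' b b' c c'. matching_type a a' b b' c c')"
proof -
  obtain p q r where pqr: "{p, q, r} \<subseteq> V" "distinct [p, q, r]" "f p q \<noteq> f q r"
  proof -
    obtain x y where xy: "x \<in> V" "y \<in> V" "x \<noteq> y"
      using many by blast
    obtain z w where zw: "z \<in> V" "w \<in> V" "z \<noteq> w" "f z w \<noteq> f x y"
      using many[of "f x y"] by blast
    from zw(1,2) show ?thesis
    proof (cases rule: edge_position[where A = "{x, y}"])
      case inside
      then show ?thesis
        using zw sym by auto
    next
      case (crossing u v)
      then show ?thesis
        using that[of x y v] that[of y x v] sym[of y x] xy zw by auto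
    next
      case disjoint
      then show ?thesis
        using that[of x y z] that[of y z w] xy zw by (cases "f y z = f x y") auto
    qed
  qed
  obtain x y where xy: "x \<in> V" "y \<in> V" "x \<noteq> y" "f x y \<notin> {f p q, f q r}"
    using many[of "f p q" "f q r" "f q r"] by auto
  have pq: "f q p = f p q"
    by (rule sym)
  from xy(1,2) consider
    (star) s a b c where "{s, a, b, c} \<subseteq> V" "distinct [s, a, b, c]" "distinct [f s a, f s b, f s c]"
  | (path) a b c d where "{a, b, c, d} \<subseteq> V" "distinct [a, b, c, d]" "distinct [f a b, f b c, f c d]"
  | (triangle) a b c where "{a, b, c} \<subseteq> V" "distinct [a, b, c]" "distinct [f a b, f b c, f a c]"
  proof (cases rule: edge_position[where A = "{p, q, r}"])
    case inside
    then have "f p r = f x y"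
      using xy sym by auto
    then show ?thesis
      using triangle[of p q r] pqr xy by auto
  next
    case (crossing u z)
    then show ?thesis
      using star[of q p r z] path[of z p q r] path[of p q r z] pqr xy pq sym[of z p] by auto
  next
    \<comment> \<open>The edge \<open>q x\<close> decides: a colour of \<open>p q\<close> or
      \<open>q r\<close> gives a path through \<open>x y\<close>, any other colour a star at
      \<open>q\<close>.\<close>
    case disjoint
    then show ?thesis
      using path[of r q x y] path[of p q x y] star[of q p r x] pqr xy pq sym[of r q]
      by (cases "f q x = f p q"; cases "f q x = f q r") auto
  qed
  then show ?thesis
  proof cases
    case star
    then show ?thesis
      using many[of "f s a" "f s b" "f s c"] rainbow_star3_and_fourth_color[of s a b c] by auto
  next
    case path
    then show ?thesis
      using many[of "f a b" "f b c" "f c d"] rainbow_P4_and_fourth_color[of a b c d] by auto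
  next
    case triangle
    then show ?thesis
      using many[of "f a b" "f b c" "f a c"] rainbow_triangle_and_fourth_color[of a b c] by auto
  qed
qed

section \<open>Extending the patterns to all vertices\<close>

definition near_monochromatic :: bool where
  "near_monochromatic \<longleftrightarrow> (\<exists>a b c m. {a, b, c} \<subseteq> V \<and> distinct [a, b, c] \<and>
     (\<forall>x\<in>V - {a}. \<forall>y\<in>V - {a}. x \<noteq> y \<longrightarrow> {x, y} \<noteq> {b, c} \<longrightarrow> f x y = m))"

definition monochromatic_off_four :: bool where
  "monochromatic_off_four \<longleftrightarrow> (\<exists>a b c d m. {a, b, c, d} \<subseteq> V \<and> distinct [a, b, c, d] \<and>
     (\<forall>x\<in>V. \<forall>y\<in>V. x \<noteq> y \<longrightarrow> \<not> {x, y} \<subseteq> {a, b, c, d} \<longrightarrow> f x y = m))"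

definition dominant_color :: "'c \<Rightarrow> bool" where
  "dominant_color m \<longleftrightarrow> (\<forall>v\<in>V. \<forall>p\<in>V. \<forall>q\<in>V. p \<noteq> v \<longrightarrow> q \<noteq> v \<longrightarrow>
     f v p \<noteq> m \<longrightarrow> f v q \<noteq> m \<longrightarrow> f v p = f v q)"

lemma near_monochromaticI:
  assumes "{a, b, c} \<subseteq> V" "distinct [a, b, c]"
    and "\<And>x y. x \<in> V - {a} \<Longrightarrow> y \<in> V - {a} \<Longrightarrow> x \<noteq> y \<Longrightarrow> {x, y} \<noteq> {b, c} \<Longrightarrow> f x y = m"
  shows near_monochromatic
  unfolding near_monochromatic_def
  by (intro exI[of _ a] exI[of _ b] exI[of _ c] exI[of _ m] conjI ballI impI) (rule assms; assumption)+

lemma monochromatic_off_fourI: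
  assumes "{a, b, c, d} \<subseteq> V" "distinct [a, b, c, d]"
    and "\<And>x y. x \<in> V \<Longrightarrow> y \<in> V \<Longrightarrow> x \<noteq> y \<Longrightarrow> \<not> {x, y} \<subseteq> {a, b, c, d} \<Longrightarrow> f x y = m"
  shows monochromatic_off_four
  unfolding monochromatic_off_four_def
  by (intro exI[of _ a] exI[of _ b] exI[of _ c] exI[of _ d] exI[of _ m] conjI ballI impI)
    (rule assms; assumption)+

text \<open>For each edge in question, three paths confine its colour to the colours of their other
  edges, and these triples meet only in \<open>f b c\<close>. The same intersection argument recurs
  for the other patterns.\<close>

lemma apex_type_extend:
  assumes "apex_type a b c d e" and v: "v \<in> V" "v \<notin> {a, b, c, d, e}"
  shows "apex_type a b c d v" "f v e = f b c"
proof -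
  note A = assms(1)[unfolded apex_type_def]
  have e: "f v e = f b c"
    using no_rainbow[of v e b a c] no_rainbow[of v e b a d] no_rainbow[of v e c a d]
      sym[of e b] sym[of e c] sym[of b a] sym[of c a] A v by auto
  have "f v b = f b c"
    using no_rainbow[of v b c a d] no_rainbow[of v b a c e] no_rainbow[of v b a d e]
      sym[of b a] sym[of c a] A v by auto
  moreover have "f v c = f b c"
    using no_rainbow[of v c b a d] no_rainbow[of v c a b e] no_rainbow[of v c a d e]
      sym[of b a] sym[of c a] sym[of c b] A v by auto
  moreover have "f v d = f b c"
    using no_rainbow[of v d b a c] no_rainbow[of v d a b e] no_rainbow[of v d a c e]
      sym[of b a] sym[of d a] sym[of d b] A v by auto
  ultimately show "apex_type a b c d v" "f v e = f b c"
    using A v e sym[of v b] sym[of v c] sym[of v d] unfolding apex_type_def by auto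
qed

lemma apex_type_near_monochromatic:
  assumes "apex_type a b c d e"
  shows near_monochromatic
proof -
  note A = assms[unfolded apex_type_def]
  \<comment> \<open>Any vertex outside the four can serve as the fifth vertex, so a second extension
    step reaches the edges between two such vertices.\<close>
  have ext: "apex_type a b c d x" if "x \<in> V - {a, b, c, d}" for x
    using apex_type_extend[OF assms, of x] assms that by (cases "x = e") auto
  have core: "f x y = f b c" if "x \<in> V - {a, b, c, d}" "y \<in> V - {a}" "x \<noteq> y" for x y
  proof (cases "y \<in> {b, c, d}")
    case True
    then show ?thesis
      using ext[OF that(1)] sym[of x] unfolding apex_type_def by auto
  next
    case False
    then show ?thesis
      using apex_type_extend(2)[OF ext[OF that(1)], of y] that sym[of x y] by auto
  qed
  have mono: "f x y = f b c" if "x \<in> V - {a}" "y \<in> V - {a}" "x \<noteq> y" "{x, y} \<noteq> {b, c}" for x y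
  proof (cases "x \<in> {b, c, d} \<and> y \<in> {b, c, d}")
    case True
    then show ?thesis
      using A that sym[of c b] sym[of d b] sym[of d c] by auto
  next
    case False
    then show ?thesis
      using core[of x y] core[of y x] that sym[of x y] by auto
  qed
  show ?thesis
  proof (rule near_monochromaticI)
    show "{a, b, c} \<subseteq> V" "distinct [a, b, c]"
      using A by auto
  qed (rule mono)
qed

lemma tailed_triangle_type_near_monochromatic:
  assumes "tailed_triangle_type a b c d e"
  shows near_monochromatic
proof -
  note A = assms[unfolded tailed_triangle_type_def]
  note S = sym[of b a] sym[of c a] sym[of c b] sym[of d a] sym[of d b] sym[of d c]
    sym[of e a] sym[of e b] sym[of e c] sym[of e d]
  have ext: "f v b = f d e \<and> f v c = f d e \<and> f v d = f d e \<and> f v e = f d e"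
    if v: "v \<in> V" "v \<notin> {a, b, c, d, e}" for v
  proof -
    have "f v d = f d e"
      using no_rainbow[of v d b a c] no_rainbow[of v d c b a] no_rainbow[of v d b c a] S A v by auto
    moreover have "f v e = f d e"
      using no_rainbow[of v e b a c] no_rainbow[of v e c b a] no_rainbow[of v e b c a] S A v by auto
    moreover have "f v b = f d e"
      using no_rainbow[of v b a c d] no_rainbow[of v b a d e] no_rainbow[of v b d a c] S A v by auto
    moreover have "f v c = f d e"
      using no_rainbow[of v c a b d] no_rainbow[of v c a d e] no_rainbow[of v c d a b] S A v by auto
    ultimately show ?thesis by blast
  qed
  have out: "f v w = f d e"
    if "v \<in> V" "v \<notin> {a, b, c, d, e}" "w \<in> V" "w \<notin> {a, b, c, d, e}" "v \<noteq> w" for v w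
    using no_rainbow[of v w b a c] no_rainbow[of v w c b a] no_rainbow[of v w b c a]
      ext[of w] S A that by auto
  have mono: "f x y = f d e" if "x \<in> V - {a}" "y \<in> V - {a}" "x \<noteq> y" "{x, y} \<noteq> {b, c}" for x y
  proof -
    consider "x \<in> {b, c, d, e}" "y \<in> {b, c, d, e}" | "x \<in> {b, c, d, e}" "y \<notin> {b, c, d, e}"
      | "x \<notin> {b, c, d, e}" "y \<in> {b, c, d, e}" | "x \<notin> {b, c, d, e}" "y \<notin> {b, c, d, e}"
      by argo
    then show ?thesis
    proof cases
      case 1
      then show ?thesis using S A that by (auto simp: doubleton_eq_iff)
    next
      case 2
      then show ?thesis using ext[of y] sym[of x y] that by auto
    next
      case 3
      then show ?thesis using ext[of x] that by auto
    next
      case 4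
      then show ?thesis using out[of x y] that by auto
    qed
  qed
  show ?thesis
  proof (rule near_monochromaticI)
    show "{a, b, c} \<subseteq> V" "distinct [a, b, c]"
      using A by auto
  qed (rule mono)
qed

lemma triangle_type_rotate: "triangle_type a b c y \<Longrightarrow> triangle_type b c a y"
  unfolding triangle_type_def using sym[of c a] sym[of b a] by auto

text \<open>The two paths from \<open>v\<close> around the triangle to \<open>y\<close> leave only
  the colour of \<open>y\<close> and that of the opposite triangle edge.\<close>

lemma triangle_type_apex_edge:
  assumes "triangle_type a b c y" and "v \<in> V" "v \<notin> {a, b, c, y}"
  shows "f v a \<in> {f a y, f b c}"
  using assms no_rainbow[of v a b c y] no_rainbow[of v a c b y] sym[of c b]
  unfolding triangle_type_def by auto

lemma triangle_type_hub_edge: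
  assumes "triangle_type a b c y" and "v \<in> V" "v \<notin> {a, b, c, y}"
  shows "f v y = f a y"
  using assms no_rainbow[of v y a b c] no_rainbow[of v y b c a] no_rainbow[of v y c a b]
    sym[of y a] sym[of y b] sym[of y c] sym[of c a]
  unfolding triangle_type_def by auto

text \<open>Each triangle vertex confines \<open>f v w\<close> to the colour of \<open>y\<close> or
  that of the opposite edge; the three opposite edges have different colours, so only the colour of
  \<open>y\<close> survives.\<close>

lemma triangle_type_outer_edge:
  assumes "triangle_type a b c y" and "v \<in> V" "v \<notin> {a, b, c, y}" "w \<in> V" "w \<notin> {a, b, c, y}" "v \<noteq> w"
  shows "f v w = f a y"
proof -
  have *: "f v w \<in> {f a y, f b c}" if "triangle_type a b c y" "{v, w} \<inter> {a, b, c, y} = {}" for a b c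
  proof -
    have "f w a = f a y \<or> f w a = f b c"
      using triangle_type_apex_edge[of a b c y w] that assms(4) by blast
    then show ?thesis
    proof
      assume "f w a = f a y"
      then show ?thesis
        using that assms(2,4,6) no_rainbow[of v w a b c] no_rainbow[of v w a c b] sym[of c b]
        unfolding triangle_type_def by auto
    next
      assume "f w a = f b c"
      then show ?thesis
        using that assms(2,4,6) no_rainbow[of v w a b y] no_rainbow[of v w a c y]
        unfolding triangle_type_def by auto
    qed
  qed
  have "f v w \<in> {f a y, f b c}" "f v w \<in> {f b y, f c a}" "f v w \<in> {f c y, f a b}"
    using *[of a b c] *[of b c a] *[of c a b] assms triangle_type_rotate by blast+
  then show ?thesis
    using assms(1) sym[of c a] unfolding triangle_type_def by auto
qed

lemma triangle_type_near_monochromatic: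
  assumes T: "triangle_type a b c y"
    and "\<forall>v\<in>V - {a, b, c, y}. f v b = f a y \<and> f v c = f a y"
  shows near_monochromatic
proof -
  note A = T[unfolded triangle_type_def]
  have mono: "f p q = f a y" if "p \<in> V - {a}" "q \<in> V - {a}" "p \<noteq> q" "{p, q} \<noteq> {b, c}" for p q
  proof -
    consider "p \<in> {b, c, y}" "q \<in> {b, c, y}" | "p \<in> {b, c, y}" "q \<notin> {b, c, y}"
      | "p \<notin> {b, c, y}" "q \<in> {b, c, y}" | "p \<notin> {b, c, y}" "q \<notin> {b, c, y}"
      by argo
    then show ?thesis
    proof cases
      case 1
      then show ?thesis using A sym[of y b] sym[of y c] that by (auto simp: doubleton_eq_iff)
    next
      case 2
      then show ?thesis using assms(2) triangle_type_hub_edge[OF T, of q] sym[of p q] that by auto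
    next
      case 3
      then show ?thesis using assms(2) triangle_type_hub_edge[OF T, of p] that by auto
    next
      case 4
      then show ?thesis using triangle_type_outer_edge[OF T, of p q] that by auto
    qed
  qed
  show ?thesis
  proof (rule near_monochromaticI)
    show "{a, b, c} \<subseteq> V" "distinct [a, b, c]"
      using A by auto
  qed (rule mono)
qed

text \<open>By the path through two triangle vertices and \<open>y\<close>, two edges from different triangle vertices
  that leave the colour of \<open>y\<close> must end in the same outer vertex.\<close>

lemma triangle_type_exceptional:
  assumes T: "triangle_type a b c y"
    and v: "v \<in> V" "v \<notin> {a, b, c, y}" and w: "w \<in> V" "w \<notin> {a, b, c, y}" and "v \<noteq> w"
  shows "f v a = f a y \<or> f w b = f a y"
proof -
  have "f w b = f a y \<or> f w b = f a c"
    using triangle_type_apex_edge[OF triangle_type_rotate[OF T], of w] T w sym[of c a]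
    unfolding triangle_type_def by auto
  moreover have "f v a = f a y \<or> f v a = f b c"
    using triangle_type_apex_edge[OF T v] by auto
  ultimately show ?thesis
    using T no_rainbow[of v a b w y] triangle_type_hub_edge[OF T w] sym[of b w] v w \<open>v \<noteq> w\<close>
    unfolding triangle_type_def by auto
qed

text \<open>Two exceptional edges at different triangle vertices end in the same vertex
  \<open>v\<close>, and then so does every exceptional edge. Hence all colours but that of
  \<open>y\<close> live inside \<open>{a, b, c, v}\<close>; \<open>y\<close> itself lies outside
  this set.\<close>

lemma triangle_type_monochromatic_off_four:
  assumes T: "triangle_type a b c y"
    and v: "v \<in> V" "v \<notin> {a, b, c, y}" "f v a \<noteq> f a y"
    and w: "w \<in> V" "w \<notin> {a, b, c, y}" "f w b \<noteq> f a y"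
  shows monochromatic_off_four
proof -
  note A = T[unfolded triangle_type_def]
  note R = triangle_type_rotate[OF T]
  have [simp]: "w = v"
    using triangle_type_exceptional[OF T v(1,2) w(1,2)] v w by auto
  have cross: "f u s = f a y" if u: "u \<in> V - {a, b, c, v}" and s: "s \<in> {a, b, c}" for u s
  proof (cases "u = y")
    case True
    then show ?thesis
      using A s sym[of y] by auto
  next
    case False
    then have u': "u \<in> V" "u \<notin> {a, b, c, y}" "u \<noteq> v"
      using u by auto
    have "f u a = f a y" "f u b = f a y"
      using triangle_type_exceptional[OF T, of u v] triangle_type_exceptional[OF T, of v u] u' v w
      by auto
    moreover have "f u c = f a y"
      using triangle_type_exceptional[OF R, of v u] u' v w A by auto
    ultimately show ?thesis
      using s by auto
  qed
  have out: "f p q = f a y" if "p \<in> V - {a, b, c}" "q \<in> V - {a, b, c}" "p \<noteq> q" for p q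
    using triangle_type_outer_edge[OF T, of p q] triangle_type_hub_edge[OF T, of p]
      triangle_type_hub_edge[OF T, of q] sym[of p q] that by (cases "p = y"; cases "q = y") auto
  have mono: "f p q = f a y" if "p \<in> V" "q \<in> V" "p \<noteq> q" "\<not> {p, q} \<subseteq> {a, b, c, v}" for p q
    using that cross[of p q] cross[of q p] out[of p q] sym[of p q]
    by (cases "p \<in> {a, b, c}"; cases "q \<in> {a, b, c}") auto
  show ?thesis
  proof (rule monochromatic_off_fourI)
    show "{a, b, c, v} \<subseteq> V" "distinct [a, b, c, v]"
      using A v by auto
  qed (rule mono)
qed

lemma triangle_type_structure:
  assumes T: "triangle_type a b c y"
  shows "near_monochromatic \<or> monochromatic_off_four"
proof (rule disjCI)
  assume n: "\<not> monochromatic_off_four"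
  define exc where "exc s \<longleftrightarrow> (\<exists>v\<in>V - {a, b, c, y}. f v s \<noteq> f a y)" for s
  note R = triangle_type_rotate[OF T] triangle_type_rotate[OF triangle_type_rotate[OF T]]
  have eq: "f b y = f a y" "f c y = f a y"
    using T unfolding triangle_type_def by auto
  have "\<not> (exc a \<and> exc b)"
    using n triangle_type_monochromatic_off_four[OF T] unfolding exc_def by blast
  moreover have "\<not> (exc b \<and> exc c)"
    using n triangle_type_monochromatic_off_four[OF R(1)] eq unfolding exc_def by simp blast
  moreover have "\<not> (exc c \<and> exc a)"
    using n triangle_type_monochromatic_off_four[OF R(2)] eq unfolding exc_def by simp blast
  \<comment> \<open>At most one triangle vertex has exceptional edges. It becomes the deleted vertex
    of \<open>near_monochromatic\<close>, and the other two span the exempt edge.\<close>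
  ultimately have "\<not> exc b \<and> \<not> exc c \<or> \<not> exc c \<and> \<not> exc a \<or> \<not> exc a \<and> \<not> exc b"
    by blast
  then show near_monochromatic
    using triangle_type_near_monochromatic[OF T] triangle_type_near_monochromatic[OF R(1)]
      triangle_type_near_monochromatic[OF R(2)] eq unfolding exc_def by (auto simp: insert_commute)
qed

text \<open>A sixth vertex \<open>v\<close> would force \<open>f v e = f d e\<close>, and then
  \<open>d a b e v\<close> is a rainbow path.\<close>

lemma sporadic_type_card:
  assumes "sporadic_type a b c d e"
  shows "V = {a, b, c, d, e}"
proof (rule ccontr)
  assume "V \<noteq> {a, b, c, d, e}"
  then obtain v where v: "v \<in> V" "v \<notin> {a, b, c, d, e}"
    using assms unfolding sporadic_type_def by blast
  note A = assms[unfolded sporadic_type_def]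
  note S = sym[of b a] sym[of c a] sym[of c b] sym[of d a] sym[of d b] sym[of d c]
    sym[of e a] sym[of e b] sym[of e c] sym[of e d]
  have e: "f v e = f d e"
    using no_rainbow[of v e d a b] no_rainbow[of v e d b a] no_rainbow[of v e d b c] S A v by auto
  show False
    using no_rainbow[of d a b e v] e sym[of e v] S A v by auto
qed

section \<open>The matching pattern and its dominant colour\<close>

lemma matching_type_swap: "matching_type a a' b b' c c' \<Longrightarrow> matching_type a' a b b' c c'"
  unfolding matching_type_def using sym[of a' a] by auto

text \<open>The common colour of the crossing edges is named by \<open>f a b\<close>; the second
  conclusion identifies it with its name after the rotation.\<close>

lemma matching_type_rotate:
  assumes "matching_type a a' b b' c c'"
  shows "matching_type b b' c c' a a'" "f b c = f a b"
proof -
  have A: "{a, a', b, b', c, c'} \<subseteq> V" "distinct [a, a', b, b', c, c']"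
      "distinct [f a a', f b b', f c c', f a b]"
    using assms unfolding matching_type_def by blast+
  have ab: "f x y = f a b" if "x \<in> {a, a'}" "y \<in> {b, b', c, c'}" for x y
    using assms that unfolding matching_type_def by blast
  have bc: "f x y = f a b" if "x \<in> {b, b'}" "y \<in> {c, c'}" for x y
    using assms that unfolding matching_type_def by blast
  show m: "f b c = f a b"
    by (rule bc) auto
  have b: "f x y = f a b" if "x \<in> {b, b'}" "y \<in> {c, c', a, a'}" for x y
    using that ab[of y x] bc[of x y] sym[of x y] by (metis insert_iff)
  have c: "f x y = f a b" if "x \<in> {c, c'}" "y \<in> {a, a'}" for x y
    using that ab[of y x] sym[of x y] by (metis insert_iff)
  show "matching_type b b' c c' a a'"
    unfolding matching_type_def m
  proof (intro conjI ballI)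
    show "{b, b', c, c', a, a'} \<subseteq> V" "distinct [b, b', c, c', a, a']"
      "distinct [f b b', f c c', f a a', f a b]"
      using A by auto
  qed (fact b c)+
qed

text \<open>The paths \<open>x a a' b b'\<close> and \<open>x a a' c c'\<close> leave only the
  crossing colour and that of the matching edge at \<open>a\<close>.\<close>

lemma matching_type_edge:
  assumes "matching_type a a' b b' c c'" "x \<in> V" "x \<noteq> a"
  shows "f a x = f a b \<or> f a x = f a a'"
proof (cases "x \<in> {a', b, b', c, c'}")
  case True
  then show ?thesis
    using assms unfolding matching_type_def by auto
next
  case False
  then show ?thesis
    using assms no_rainbow[of x a a' b b'] no_rainbow[of x a a' c c'] sym[of x a]
    unfolding matching_type_def by auto
qed

text \<open>If \<open>v p\<close> and \<open>v q\<close> had different colours, the path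
  \<open>p v q c\<close> could be continued to \<open>c'\<close> or, when \<open>q c\<close> already
  has the colour of \<open>c c'\<close>, to a vertex of another pair, and would be rainbow.\<close>

lemma matching_type_third_color:
  assumes M: "matching_type a a' b b' c c'"
    and v: "v \<in> V" "v \<notin> {a, a', b, b', c, c'}"
    and p: "p \<in> V" "p \<noteq> v" "f v p \<noteq> f a b" "f v p \<noteq> f c c'"
    and q: "q \<in> V" "q \<noteq> v" "f v q \<noteq> f a b" "f v q \<noteq> f c c'"
  shows "f v p = f v q"
proof (rule ccontr)
  assume ne: "f v p \<noteq> f v q"
  note A = M[unfolded matching_type_def]
  note M1 = matching_type_rotate(1)[OF matching_type_rotate(1)[OF M]]
  have m: "f c a = f a b" "f c b = f a b" "f c' a = f a b" "f c' c = f c c'"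
    using A sym[of c a] sym[of c b] sym[of c' a] sym[of c' c] by auto
  have c: "f c x = f a b \<or> f c x = f c c'" if "x \<in> V" "x \<noteq> c" for x
    using matching_type_edge[OF M1 that] m by auto
  have c': "f c' x = f a b \<or> f c' x = f c c'" if "x \<in> V" "x \<noteq> c'" for x
    using matching_type_edge[OF matching_type_swap[OF M1] that] m by auto
  have notin: "p \<notin> {c, c'}" "q \<notin> {c, c'}"
    using c[of v] c'[of v] v p q sym[of v c] sym[of v c'] by auto
  have "f c z = f a b" if "z \<in> {a, a', b, b'}" for z
    using A sym[of c z] that by auto
  moreover have "f c q = f a b \<or> f c q = f c c'"
    using c[of q] q notin by blast
  ultimately consider "f c q = f a b" | "f c q = f c c'" "q \<notin> {a, a', b, b'}"
    by blast
  moreover have D: "{a, b, c, c'} \<subseteq> V" "distinct [a, b, c, c']" "f a b \<noteq> f c c'" "p \<noteq> q"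
    using A ne by auto
  ultimately show False
  proof cases
    case 1
    then show False
      using no_rainbow[of p v q c c'] sym[of p v] sym[of q c] ne p q v notin D by auto
  next
    case 2
    obtain z where "z \<in> {a, b}" "z \<noteq> p"
      using D by (cases "p = a") auto
    then show False
      using 2 no_rainbow[of p v q c z] sym[of p v] sym[of q c] ne p q v notin m D by auto
  qed
qed

lemma matching_type_dominant_color:
  assumes M: "matching_type a a' b b' c c'"
  shows "dominant_color (f a b)"
  unfolding dominant_color_def
proof (intro ballI impI)
  fix v p q
  assume v: "v \<in> V" and p: "p \<in> V" "p \<noteq> v" "f v p \<noteq> f a b" and q: "q \<in> V" "q \<noteq> v" "f v q \<noteq> f a b"
  note M1 = matching_type_rotate[OF M]
  note M2 = matching_type_rotate[OF M1(1)]
  note A = M[unfolded matching_type_def]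
  have eqs: "f a' b = f a b" "f b' c = f a b" "f c' a = f a b"
    using A sym[of c' a] by auto
  show "f v p = f v q"
  proof (cases "v \<in> {a, a', b, b', c, c'}")
    case True
    then show ?thesis
      using matching_type_edge[OF M, of p] matching_type_edge[OF M, of q]
        matching_type_edge[OF M1(1), of p] matching_type_edge[OF M1(1), of q]
        matching_type_edge[OF M2(1), of p] matching_type_edge[OF M2(1), of q]
        matching_type_edge[OF matching_type_swap[OF M], of p]
        matching_type_edge[OF matching_type_swap[OF M], of q]
        matching_type_edge[OF matching_type_swap[OF M1(1)], of p]
        matching_type_edge[OF matching_type_swap[OF M1(1)], of q]
        matching_type_edge[OF matching_type_swap[OF M2(1)], of p]
        matching_type_edge[OF matching_type_swap[OF M2(1)], of q] p q M1(2) M2(2) eqs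
      by (elim insertE) simp_all
  next
    case False
    \<comment> \<open>Two colours cannot hit all three matching colours; by rotation the pair whose
      colour is avoided may be taken as \<open>c c'\<close>.\<close>
    have "f v p \<noteq> f a a' \<and> f v q \<noteq> f a a' \<or> f v p \<noteq> f b b' \<and> f v q \<noteq> f b b' \<or>
        f v p \<noteq> f c c' \<and> f v q \<noteq> f c c'"
      using A by auto
    then show ?thesis
      using matching_type_third_color[OF M v, of p q] matching_type_third_color[OF M1(1) v, of p q]
        matching_type_third_color[OF M2(1) v, of p q] p q False M1(2) M2(2) by auto
  qed
qed

section \<open>Structure of colourings with at least four colours\<close>

text \<open>The sporadic pattern, which lives on five vertices only, is the case that the bound on
  \<open>card V\<close> has to exclude.\<close>

theorem rainbow_P5_free_structure:
  assumes "6 \<le> card V" and "\<And>i j k. \<exists>x\<in>V. \<exists>y\<in>V. x \<noteq> y \<and> f x y \<notin> {i, j, k}"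
  shows "near_monochromatic \<or> monochromatic_off_four \<or> (\<exists>m. dominant_color m)"
  using structured_or_matching_type[OF assms(2)]
proof
  assume structured
  then obtain a b c d e where "apex_type a b c d e \<or> triangle_type a b c d \<or>
      tailed_triangle_type a b c d e \<or> sporadic_type a b c d e"
    unfolding structured_def by blast
  moreover have "\<not> sporadic_type a b c d e"
  proof
    assume "sporadic_type a b c d e"
    then have "card V \<le> 5"
      using sporadic_type_card card_length[of "[a, b, c, d, e]"] by simp
    then show False
      using assms(1) by simp
  qed
  ultimately show ?thesis
    using apex_type_near_monochromatic tailed_triangle_type_near_monochromatic
      triangle_type_structure by blast
next
  assume "\<exists>a a' b b' c c'. matching_type a a' b b' c c'"
  then obtain a a' b b' c c' where "matching_type a a' b b' c c'"
    by blast
  then show ?thesis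
    using matching_type_dominant_color[of a a' b b' c c'] by blast
qed

text \<open>Serves the case \<open>N = 5\<close>, where \<open>H\<close> is a star with at most two
  edges. Every pattern contains two incident edges of one colour, and the matching pattern does not
  fit on five vertices.\<close>

lemma ex_monochromatic_P3:
  assumes "card V = 5" and "\<And>i j k. \<exists>x\<in>V. \<exists>y\<in>V. x \<noteq> y \<and> f x y \<notin> {i, j, k}"
  obtains x p q where "{x, p, q} \<subseteq> V" "distinct [x, p, q]" "f x p = f x q"
proof -
  have "\<not> matching_type a a' b b' c c'" for a a' b b' c c'
  proof
    assume "matching_type a a' b b' c c'"
    then have "{a, a', b, b', c, c'} \<subseteq> V" and d: "distinct [a, a', b, b', c, c']"
      unfolding matching_type_def by blast+
    then have "set [a, a', b, b', c, c'] \<subseteq> V"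
      by simp
    moreover have "finite V"
      using assms(1) card.infinite by fastforce
    ultimately have "length [a, a', b, b', c, c'] \<le> card V"
      using distinct_card[OF d] card_mono by metis
    then show False
      using assms(1) by simp
  qed
  then have structured
    using structured_or_matching_type[OF assms(2)] by blast
  then obtain a b c d e where "apex_type a b c d e \<or> triangle_type a b c d \<or>
      tailed_triangle_type a b c d e \<or> sporadic_type a b c d e"
    unfolding structured_def by blast
  then show thesis
  proof (elim disjE)
    assume "apex_type a b c d e"
    then show thesis
      using that[of b c d] unfolding apex_type_def by simp
  next
    assume "triangle_type a b c d"
    then show thesis
      using that[of d a b] sym[of d a] sym[of d b] unfolding triangle_type_def by auto
  next
    assume "tailed_triangle_type a b c d e"
    then show thesis
      using that[of a d e] unfolding tailed_triangle_type_def by simp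
  next
    assume "sporadic_type a b c d e"
    then show thesis
      using that[of a d e] unfolding sporadic_type_def by simp
  qed
qed

end

section \<open>Embeddings and recolourings\<close>

text \<open>A monochromatic clique on \<open>card (verts H)\<close> vertices holds a copy of
  \<open>H\<close>, so Ramsey's theorem for cliques suffices. This makes the \<open>LEAST\<close> in
  \<open>ramsey_number\<close> meaningful.\<close>

lemma ex_ramsey_bound:
  assumes "finite_graph H"
  shows "\<exists>n. \<forall>c \<in> edges (complete_graph n) \<rightarrow> {1..k}.
    \<exists>K. is_copy_in K H (complete_graph n) \<and> monochromatic_graph c K"
proof -
  obtain n :: nat where n: "partn_lst {..<n} (replicate k (card (verts H))) 2"
    using ramsey_full by blast
  have "\<exists>K. is_copy_in K H (complete_graph n) \<and> monochromatic_graph c K"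
    if c: "c \<in> edges (complete_graph n) \<rightarrow> {1..k}" for c
  proof -
    have "(\<lambda>e. c e - 1) \<in> [{..<n}]\<^bsup>2\<^esup> \<rightarrow> {..<k}"
    proof
      fix e :: "nat set"
      assume "e \<in> [{..<n}]\<^bsup>2\<^esup>"
      then have "c e \<in> {1..k}"
        using c by (auto simp: complete_graph_def)
      then show "c e - 1 \<in> {..<k}"
        by auto
    qed
    then obtain i W where "i < k" and W: "W \<in> [{..<n}]\<^bsup>card (verts H)\<^esup>"
      and i: "(\<lambda>e. c e - 1) ` [W]\<^bsup>2\<^esup> \<subseteq> {i}"
      by (rule partn_lstE[OF n]) auto
    have W': "finite W" "W \<subseteq> {..<n}" "card W = card (verts H)"
      using W by (auto simp: nsets_def)
    then obtain \<phi> where \<phi>: "bij_betw \<phi> (verts H) W"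
      using assms finite_same_card_bij unfolding finite_graph_def by metis
    let ?K = "(W, (\<lambda>e. \<phi> ` e) ` edges H)"
    have sub: "edges ?K \<subseteq> [W]\<^bsup>2\<^esup>"
    proof
      fix e'
      assume "e' \<in> edges ?K"
      then obtain e where e: "e \<in> edges H" "e' = \<phi> ` e"
        by auto
      then obtain x y where "e = {x, y}" "x \<in> verts H" "y \<in> verts H" "x \<noteq> y"
        using assms unfolding finite_graph_def by (blast elim: nsets2_E)
      then show "e' \<in> [W]\<^bsup>2\<^esup>"
        using e \<phi> by (auto simp: bij_betw_def inj_on_eq_iff)
    qed
    have "[W]\<^bsup>2\<^esup> \<subseteq> edges (complete_graph n)"
      using W' by (simp add: complete_graph_def nsets_mono)
    have "c e = Suc i" if "e \<in> edges ?K" for e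
    proof -
      have e: "e \<in> [W]\<^bsup>2\<^esup>"
        using that sub by blast
      then have "c e \<in> {1..k}"
        using c \<open>[W]\<^bsup>2\<^esup> \<subseteq> edges (complete_graph n)\<close> by blast
      moreover have "c e - 1 = i"
        using e i by blast
      ultimately show ?thesis
        by (simp, linarith)
    qed
    then have "monochromatic_graph c ?K"
      unfolding monochromatic_graph_def by metis
    moreover have "is_copy_in ?K H (complete_graph n)"
      using sub \<phi> W' \<open>[W]\<^bsup>2\<^esup> \<subseteq> edges (complete_graph n)\<close>
      unfolding is_copy_in_def subgraph_def graph_iso_def complete_graph_def by auto
    ultimately show ?thesis
      by blast
  qed
  then show ?thesis
    by blast
qed

section \<open>A graph and a number with the Ramsey property\<close>

text \<open>In the application \<open>k\<close> is \<chi>(H) and \<open>N\<close> the Ramsey number;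
  they enter only through the proper colouring \<open>\<kappa>\<close> and the existence of
  monochromatic copies.\<close>

locale ramsey_graph =
  fixes H :: "'a graph" and N k :: nat and \<kappa> :: "'a \<Rightarrow> nat"
  assumes graph: "finite_graph H" and edges_ne: "edges H \<noteq> {}"
    and coloring: "proper_vertex_coloring H k \<kappa>"
    and ramsey: "\<And>c. c \<in> edges (complete_graph N) \<rightarrow> {1..k + 1} \<Longrightarrow>
      \<exists>K. is_copy_in K H (complete_graph N) \<and> monochromatic_graph c K"
begin

text \<open>Isolated vertices carry no colours, so embeddings are built on the remaining vertices
  and extended in \<open>contains_monochromatic_copy\<close>.\<close>

definition support :: "'a set" where
  "support = \<Union> (edges H)"

definition embedding :: "('a \<Rightarrow> nat) \<Rightarrow> bool" where
  "embedding \<phi> \<longleftrightarrow> inj_on \<phi> support \<and> \<phi> ` support \<subseteq> {..<N}"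

definition star :: bool where
  "star \<longleftrightarrow> (\<exists>z\<in>support. \<forall>e\<in>edges H. z \<in> e)"

definition contains_monochromatic :: "(nat set \<Rightarrow> 'c) \<Rightarrow> bool" where
  "contains_monochromatic c \<longleftrightarrow> (\<exists>\<phi> m. embedding \<phi> \<and> (\<forall>e\<in>edges H. c (\<phi> ` e) = m))"

lemma edgeE:
  assumes "e \<in> edges H"
  obtains u v where "e = {u, v}" "u \<noteq> v" "u \<in> support" "v \<in> support"
proof -
  obtain u v where "e = {u, v}" "u \<noteq> v"
    using assms graph unfolding finite_graph_def by (blast elim: nsets2_E)
  then show ?thesis
    using that assms unfolding support_def by blast
qed

lemma support_subset: "support \<subseteq> verts H"
  using graph unfolding support_def finite_graph_def nsets_def by auto

lemma finite_support: "finite support"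
  using support_subset graph finite_subset unfolding finite_graph_def by blast

lemma ex_edge:
  obtains u v where "{u, v} \<in> edges H" "u \<noteq> v" "u \<in> support" "v \<in> support"
proof -
  obtain e where e: "e \<in> edges H"
    using edges_ne by blast
  then obtain u v where "e = {u, v}" "u \<noteq> v" "u \<in> support" "v \<in> support"
    by (rule edgeE)
  then show thesis
    using that e by blast
qed

lemma embedding_edge:
  assumes "embedding \<phi>" "e \<in> edges H"
  shows "\<phi> ` e \<in> [{..<N}]\<^bsup>2\<^esup>"
  using assms(2)
proof (rule edgeE)
  fix u v
  assume "e = {u, v}" "u \<noteq> v" "u \<in> support" "v \<in> support"
  then show ?thesis
    using assms(1) unfolding embedding_def by (auto simp: inj_on_eq_iff)
qed

lemma embedding_support_card: "embedding \<phi> \<Longrightarrow> card (\<phi> ` support) = card support"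
  unfolding embedding_def by (simp add: card_image)

text \<open>Only the number of colours that occur matters: they are renamed injectively into
  \<open>{1..k + 1}\<close>. The bound on \<open>card (verts H)\<close> records that all of
  \<open>H\<close>, isolated vertices included, fits into \<open>K\<^sub>N\<close>.\<close>

lemma ex_monochromatic_embedding:
  fixes c :: "nat set \<Rightarrow> 'c"
  assumes "card (c ` [{..<N}]\<^bsup>2\<^esup>) \<le> k + 1"
  obtains \<phi> m where "embedding \<phi>" "\<And>e. e \<in> edges H \<Longrightarrow> c (\<phi> ` e) = m" "card (verts H) \<le> N"
proof -
  have "finite (c ` [{..<N}]\<^bsup>2\<^esup>)"
    by (simp add: finite_imp_finite_nsets)
  then obtain g where g: "inj_on g (c ` [{..<N}]\<^bsup>2\<^esup>)" "g ` (c ` [{..<N}]\<^bsup>2\<^esup>) \<subseteq> {1..k + 1}"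
    using assms inj_on_iff_card_le[of "c ` [{..<N}]\<^bsup>2\<^esup>" "{1..k + 1}"] by auto
  have "(\<lambda>e. g (c e)) \<in> edges (complete_graph N) \<rightarrow> {1..k + 1}"
    using g(2) unfolding complete_graph_def by auto
  from ramsey[OF this] obtain K where copy: "is_copy_in K H (complete_graph N)"
    and mono: "monochromatic_graph (\<lambda>e. g (c e)) K"
    by blast
  then obtain \<phi> where \<phi>: "bij_betw \<phi> (verts H) (verts K)" "edges K = (\<lambda>e. \<phi> ` e) ` edges H"
    unfolding is_copy_in_def graph_iso_def by blast
  have K: "verts K \<subseteq> {..<N}" "edges K \<subseteq> [{..<N}]\<^bsup>2\<^esup>"
    using copy unfolding is_copy_in_def subgraph_def complete_graph_def by auto
  obtain e0 where e0: "e0 \<in> edges H"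
    using edges_ne by blast
  show ?thesis
  proof
    show "embedding \<phi>"
      unfolding embedding_def
    proof
      show "inj_on \<phi> support"
        using \<phi>(1) support_subset by (auto simp: bij_betw_def intro: inj_on_subset)
      show "\<phi> ` support \<subseteq> {..<N}"
        using \<phi>(1) support_subset K(1) by (metis bij_betw_def image_mono order_trans)
    qed
    show "c (\<phi> ` e) = c (\<phi> ` e0)" if "e \<in> edges H" for e
    proof -
      have "\<phi> ` e \<in> edges K" "\<phi> ` e0 \<in> edges K"
        using that e0 \<phi>(2) by auto
      then show ?thesis
        using mono K(2) inj_onD[OF g(1)] unfolding monochromatic_graph_def by blast
    qed
    have "card (verts H) = card (verts K)"
      using \<phi>(1) by (rule bij_betw_same_card)
    then show "card (verts H) \<le> N"
      using card_mono[OF _ K(1)] by simp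
  qed
qed

lemma few_colors:
  assumes "card (c ` [{..<N}]\<^bsup>2\<^esup>) \<le> k + 1"
  shows "contains_monochromatic c"
proof (rule ex_monochromatic_embedding[OF assms])
  fix \<phi> m
  assume "embedding \<phi>" "\<And>e. e \<in> edges H \<Longrightarrow> c (\<phi> ` e) = m"
  then show ?thesis
    unfolding contains_monochromatic_def by blast
qed

lemma card_verts_le: "card (verts H) \<le> N"
proof -
  \<comment> \<open>A constant colouring is enough to extract the size bound.\<close>
  have "card ((\<lambda>_. ()) ` [{..<N}]\<^bsup>2\<^esup>) \<le> card {()}"
    by (intro card_mono) auto
  then have "card ((\<lambda>_. ()) ` [{..<N}]\<^bsup>2\<^esup>) \<le> k + 1"
    by simp
  then show ?thesis
    by (rule ex_monochromatic_embedding)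
qed

lemma card_support_le: "card support \<le> N"
proof -
  have "card support \<le> card (verts H)"
    using graph support_subset unfolding finite_graph_def by (simp add: card_mono)
  then show ?thesis
    using card_verts_le by (rule order_trans)
qed

lemma contains_monochromatic_copy:
  assumes "contains_monochromatic c"
  shows "\<exists>K. is_copy_in K H (complete_graph N) \<and> monochromatic_graph c K"
proof -
  obtain \<phi> m where \<phi>: "inj_on \<phi> support" "\<phi> ` support \<subseteq> {..<N}"
    and m: "\<And>e. e \<in> edges H \<Longrightarrow> c (\<phi> ` e) = m"
    using assms unfolding contains_monochromatic_def embedding_def by auto
  have fin: "finite (verts H)"
    using graph unfolding finite_graph_def by simp
  have "card (verts H - support) \<le> card ({..<N} - \<phi> ` support)"
    using card_verts_le \<phi> finite_support support_subset
    by (simp add: card_Diff_subset card_image)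
  then obtain \<psi> where \<psi>: "\<psi> ` (verts H - support) \<subseteq> {..<N} - \<phi> ` support"
    "inj_on \<psi> (verts H - support)"
    using card_le_inj[of "verts H - support" "{..<N} - \<phi> ` support"] fin by auto
  define \<theta> where "\<theta> v = (if v \<in> support then \<phi> v else \<psi> v)" for v
  have inj: "inj_on \<theta> (verts H)"
  proof (rule inj_onI)
    fix x y
    assume "x \<in> verts H" "y \<in> verts H" "\<theta> x = \<theta> y"
    then show "x = y"
      using \<phi>(1) \<psi> unfolding \<theta>_def by (auto split: if_splits dest: inj_onD)
  qed
  have im: "\<theta> ` verts H \<subseteq> {..<N}"
    using \<phi>(2) \<psi>(1) unfolding \<theta>_def by auto
  have eq: "\<theta> ` e = \<phi> ` e" if "e \<in> edges H" for e
    using that unfolding \<theta>_def support_def by (auto intro!: image_cong)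
  let ?K = "(\<theta> ` verts H, (\<lambda>e. \<theta> ` e) ` edges H)"
  have "\<theta> ` e \<in> [\<theta> ` verts H]\<^bsup>2\<^esup>" if "e \<in> edges H" for e
    using that
  proof (rule edgeE)
    fix u v
    assume "e = {u, v}" "u \<noteq> v" "u \<in> support" "v \<in> support"
    then show ?thesis
      using inj support_subset by (auto simp: inj_on_eq_iff subset_iff)
  qed
  then have sub: "edges ?K \<subseteq> [verts ?K]\<^bsup>2\<^esup>"
    by auto
  have "[verts ?K]\<^bsup>2\<^esup> \<subseteq> [{..<N}]\<^bsup>2\<^esup>"
    using im by (simp add: nsets_mono)
  then have "subgraph ?K (complete_graph N)"
    using sub im unfolding subgraph_def complete_graph_def by simp
  moreover have "graph_iso H ?K"
    unfolding graph_iso_def using inj by (auto simp: bij_betw_def)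
  moreover have "monochromatic_graph c ?K"
    unfolding monochromatic_graph_def using eq m by simp
  ultimately show ?thesis
    unfolding is_copy_in_def by blast
qed

text \<open>The two ends of an edge have different colours. Hence three colours are always available
  for the test colourings below.\<close>

lemma two_le_k: "2 \<le> k"
proof -
  obtain u v where "{u, v} \<in> edges H" "u \<in> support" "v \<in> support"
    by (rule ex_edge)
  then have "\<kappa> u < k" "\<kappa> v < k" "\<kappa> u \<noteq> \<kappa> v"
    using coloring support_subset unfolding proper_vertex_coloring_def by auto
  then show ?thesis
    by linarith
qed

lemma starI:
  assumes "embedding \<phi>" and "\<And>e. e \<in> edges H \<Longrightarrow> p \<in> \<phi> ` e"
  shows star
proof -
  obtain u v where uv: "{u, v} \<in> edges H" "u \<in> support" "v \<in> support"
    by (rule ex_edge)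
  then obtain z where z: "z \<in> support" "p = \<phi> z"
    using assms(2)[OF uv(1)] by blast
  have "z \<in> e" if e: "e \<in> edges H" for e
  proof -
    obtain z' where "z' \<in> e" "\<phi> z' = \<phi> z"
      using assms(2)[OF e] z by auto
    then show ?thesis
      using assms(1) e z(1) unfolding embedding_def support_def by (metis UnionI inj_onD)
  qed
  then show ?thesis
    using z(1) unfolding star_def by blast
qed

section \<open>Embeddings into cliques, stars and multipartite graphs\<close>

lemma embed_in_clique:
  assumes "W \<subseteq> {..<N}" "card support \<le> card W"
    and "\<And>x y. x \<in> W \<Longrightarrow> y \<in> W \<Longrightarrow> x \<noteq> y \<Longrightarrow> c {x, y} = m"
  shows "contains_monochromatic c"
proof -
  have "finite W"
    using assms(1) finite_subset by auto
  then obtain \<phi> where \<phi>: "\<phi> ` support \<subseteq> W" "inj_on \<phi> support"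
    using card_le_inj[OF finite_support _ assms(2)] by auto
  then have "embedding \<phi>"
    using assms(1) unfolding embedding_def by blast
  moreover have "c (\<phi> ` e) = m" if "e \<in> edges H" for e
    using that
  proof (rule edgeE)
    fix u v
    assume "e = {u, v}" "u \<noteq> v" "u \<in> support" "v \<in> support"
    then show ?thesis
      using \<phi> assms(3)[of "\<phi> u" "\<phi> v"] by (auto simp: inj_on_eq_iff)
  qed
  ultimately show ?thesis
    unfolding contains_monochromatic_def by blast
qed

lemma embed_star:
  assumes star and "x < N" "D \<subseteq> {..<N} - {x}" "card support \<le> card D + 1"
    and "\<And>y. y \<in> D \<Longrightarrow> c {x, y} = m"
  shows "contains_monochromatic c"
proof -
  obtain z where z: "z \<in> support" "\<And>e. e \<in> edges H \<Longrightarrow> z \<in> e"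
    using \<open>star\<close> unfolding star_def by blast
  have "card (support - {z}) \<le> card D"
    using assms(4) z(1) finite_support by simp
  then obtain \<phi> where \<phi>: "\<phi> ` (support - {z}) \<subseteq> D" "inj_on \<phi> (support - {z})"
    using card_le_inj[of "support - {z}" D] finite_support assms(3) finite_subset[of D] by auto
  define \<theta> where "\<theta> = \<phi>(z := x)"
  have "embedding \<theta>"
    unfolding embedding_def
  proof
    show "inj_on \<theta> support"
    proof (rule inj_onI)
      fix u v
      assume "u \<in> support" "v \<in> support" "\<theta> u = \<theta> v"
      then show "u = v"
        using \<phi> assms(3) unfolding \<theta>_def by (auto split: if_splits dest: inj_onD)
    qed
    show "\<theta> ` support \<subseteq> {..<N}"
      using \<phi>(1) assms(2,3) unfolding \<theta>_def by auto
  qed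
  moreover have "c (\<theta> ` e) = m" if e: "e \<in> edges H" for e
  proof -
    obtain v w where "e = {v, w}" "v \<noteq> w" "v \<in> support" "w \<in> support"
      using e by (rule edgeE)
    then obtain u where "e = {z, u}" "u \<noteq> z" "u \<in> support"
      using z(2)[OF e] by auto
    then show ?thesis
      using \<phi>(1) assms(5)[of "\<phi> u"] unfolding \<theta>_def by (auto simp: insert_commute)
  qed
  ultimately show ?thesis
    unfolding contains_monochromatic_def by blast
qed

lemma embed_multipartite:
  assumes sub: "\<And>i. i < k \<Longrightarrow> T i \<subseteq> {..<N}"
    and card: "\<And>i. i < k \<Longrightarrow> card {u \<in> support. \<kappa> u = i} \<le> card (T i)"
    and disj: "\<And>i j. i < k \<Longrightarrow> j < k \<Longrightarrow> i \<noteq> j \<Longrightarrow> T i \<inter> T j = {}"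
    and cross: "\<And>i j x y. i < k \<Longrightarrow> j < k \<Longrightarrow> i \<noteq> j \<Longrightarrow> x \<in> T i \<Longrightarrow> y \<in> T j \<Longrightarrow> c {x, y} = m"
  shows "contains_monochromatic c"
proof -
  have "\<exists>g. g ` {u \<in> support. \<kappa> u = i} \<subseteq> T i \<and> inj_on g {u \<in> support. \<kappa> u = i}" if "i < k" for i
    using card_le_inj[OF _ _ card[OF that]] finite_support finite_subset[OF sub[OF that]] by auto
  then obtain g where g: "\<And>i. i < k \<Longrightarrow> g i ` {u \<in> support. \<kappa> u = i} \<subseteq> T i"
    "\<And>i. i < k \<Longrightarrow> inj_on (g i) {u \<in> support. \<kappa> u = i}"
    by metis
  define \<phi> where "\<phi> u = g (\<kappa> u) u" for u
  have k: "\<kappa> u < k" if "u \<in> support" for u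
    using that coloring support_subset unfolding proper_vertex_coloring_def by auto
  have T: "\<phi> u \<in> T (\<kappa> u)" if "u \<in> support" for u
    using g(1)[OF k[OF that]] that unfolding \<phi>_def by auto
  have "embedding \<phi>"
    unfolding embedding_def
  proof
    show "inj_on \<phi> support"
    proof (rule inj_onI)
      fix u v
      assume uv: "u \<in> support" "v \<in> support" "\<phi> u = \<phi> v"
      then have "\<kappa> u = \<kappa> v"
        using T[of u] T[of v] disj[OF k[of u] k[of v]] by auto
      then show "u = v"
        using g(2)[OF k[OF uv(1)]] uv unfolding \<phi>_def by (auto dest: inj_onD)
    qed
    show "\<phi> ` support \<subseteq> {..<N}"
      using T k sub by blast
  qed
  moreover have "c (\<phi> ` e) = m" if "e \<in> edges H" for e
    using that
  proof (rule edgeE)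
    fix u v
    assume uv: "e = {u, v}" "u \<in> support" "v \<in> support"
    then have "\<kappa> u \<noteq> \<kappa> v"
      using that coloring support_subset unfolding proper_vertex_coloring_def by auto
    then show ?thesis
      using cross[OF k k _ T T, of u v] uv by simp
  qed
  ultimately show ?thesis
    unfolding contains_monochromatic_def by blast
qed

section \<open>Test colourings that restrict the graph\<close>

text \<open>Applied to test colourings with at most \<open>k + 1\<close> values: the support embeds
  into one colour class, whose shape then restricts \<open>H\<close>.\<close>

lemma recoloring:
  fixes c :: "nat set \<Rightarrow> nat"
  assumes "\<And>e. c e \<in> set ms" "length ms \<le> k + 1"
  obtains \<phi> m where "embedding \<phi>" "m \<in> set ms" "\<And>e. e \<in> edges H \<Longrightarrow> c (\<phi> ` e) = m"
proof -
  have "card (c ` [{..<N}]\<^bsup>2\<^esup>) \<le> card (set ms)"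
    using assms(1) by (intro card_mono) auto
  also have "\<dots> \<le> k + 1"
    using card_length[of ms] assms(2) by simp
  finally obtain \<phi> m where \<phi>: "embedding \<phi>" and m: "\<And>e. e \<in> edges H \<Longrightarrow> c (\<phi> ` e) = m"
    using few_colors unfolding contains_monochromatic_def by metis
  obtain u v where "{u, v} \<in> edges H"
    by (rule ex_edge)
  then have "m \<in> set ms"
    using m assms(1) by metis
  then show ?thesis
    using that \<phi> m by blast
qed

lemma support_avoids:
  assumes "embedding \<phi>" and "\<And>e. e \<in> edges H \<Longrightarrow> \<phi> ` e \<inter> A = {}" and "A \<subseteq> {..<N}"
  shows "card support \<le> N - card A"
proof -
  have "\<phi> ` support \<subseteq> {..<N} - A"
    using assms(1,2) unfolding embedding_def support_def by blast
  then have "card (\<phi> ` support) \<le> card ({..<N} - A)"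
    by (intro card_mono) auto
  then show ?thesis
    using assms(1,3) embedding_support_card finite_subset[OF assms(3)] by (simp add: card_Diff_subset)
qed

text \<open>Each of the three test classes misses a vertex: the edges avoiding 0 miss 0, the single
  edge \<open>{0, 1}\<close> misses 2, and the other edges at 0 miss 1.\<close>

lemma card_support_less:
  assumes "3 \<le> N"
  shows "card support \<le> N - 1"
proof -
  define c :: "nat set \<Rightarrow> nat" where "c e = (if 0 \<notin> e then 0 else if e = {0, 1} then 2 else 3)" for e
  have c_eq: "c e = 0 \<longleftrightarrow> 0 \<notin> e" "c e = 2 \<longleftrightarrow> e = {0, 1}" "c e = 3 \<longleftrightarrow> 0 \<in> e \<and> e \<noteq> {0, 1}" for e
    by (auto simp: c_def)
  have "c e \<in> set [0, 2, 3]" for e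
    by (simp add: c_def)
  then obtain \<phi> m where \<phi>: "embedding \<phi>" and m: "m \<in> set [0, 2, 3]"
    and c: "\<And>e. e \<in> edges H \<Longrightarrow> c (\<phi> ` e) = m"
    using two_le_k by (rule_tac recoloring[of c "[0, 2, 3]"]) auto
  consider "m = 0" | "m = 2" | "m = 3"
    using m by auto
  then show ?thesis
  proof cases
    case 1
    then have "\<phi> ` e \<inter> {0} = {}" if "e \<in> edges H" for e
      using c[OF that] by (simp add: c_eq)
    then show ?thesis
      using support_avoids[OF \<phi>, of "{0}"] assms by simp
  next
    case 2
    then have "\<phi> ` e = {0, 1}" if "e \<in> edges H" for e
      using c[OF that] by (simp add: c_eq)
    then have "\<phi> ` e \<inter> {2} = {}" if "e \<in> edges H" for e
      using that by simp
    then show ?thesis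
      using support_avoids[OF \<phi>, of "{2}"] assms by simp
  next
    case 3
    have "\<phi> ` e \<inter> {1} = {}" if e: "e \<in> edges H" for e
    proof -
      have "0 \<in> \<phi> ` e" "\<phi> ` e \<noteq> {0, 1}"
        using c[OF e] 3 by (simp_all add: c_eq)
      moreover obtain x y where "\<phi> ` e = {x, y}"
        using embedding_edge[OF \<phi> e] by (rule nsets2_E)
      ultimately show ?thesis
        by auto
    qed
    then show ?thesis
      using support_avoids[OF \<phi>, of "{1}"] assms by simp
  qed
qed

text \<open>The test classes are the star at 0, the remaining star at 1, and the edges that avoid
  both 0 and 1.\<close>

lemma star_or_card_support:
  assumes "2 \<le> N"
  shows "star \<or> card support \<le> N - 2"
proof -
  define c :: "nat set \<Rightarrow> nat" where "c e = (if 0 \<in> e then 0 else if 1 \<in> e then 2 else 3)" for e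
  have c_eq: "c e = 0 \<longleftrightarrow> 0 \<in> e" "c e = 2 \<longleftrightarrow> 0 \<notin> e \<and> 1 \<in> e" "c e = 3 \<longleftrightarrow> 0 \<notin> e \<and> 1 \<notin> e" for e
    by (auto simp: c_def)
  have "c e \<in> set [0, 2, 3]" for e
    by (simp add: c_def)
  then obtain \<phi> m where \<phi>: "embedding \<phi>" and m: "m \<in> set [0, 2, 3]"
    and c: "\<And>e. e \<in> edges H \<Longrightarrow> c (\<phi> ` e) = m"
    using two_le_k by (rule_tac recoloring[of c "[0, 2, 3]"]) auto
  consider "m = 0" | "m = 2" | "m = 3"
    using m by auto
  then show ?thesis
  proof cases
    case 1
    then have "0 \<in> \<phi> ` e" if "e \<in> edges H" for e
      using c[OF that] by (simp add: c_eq)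
    then show ?thesis
      using starI[OF \<phi>] by blast
  next
    case 2
    then have "1 \<in> \<phi> ` e" if "e \<in> edges H" for e
      using c[OF that] by (simp add: c_eq)
    then show ?thesis
      using starI[OF \<phi>] by blast
  next
    case 3
    then have "\<phi> ` e \<inter> {0, 1} = {}" if "e \<in> edges H" for e
      using c[OF that] by (simp add: c_eq)
    then show ?thesis
      using support_avoids[OF \<phi>, of "{0, 1}"] assms by (simp add: numeral_2_eq_2)
  qed
qed

text \<open>If no vertex of the triangle covered all edges, each of its three edges would be used,
  and \<open>H\<close> would contain a triangle, which has no proper colouring with two
  colours.\<close>

lemma bipartite_in_triangle_star:
  assumes "k = 2" and \<phi>: "embedding \<phi>" and "distinct [q, r, s]"
    and sub: "\<And>e. e \<in> edges H \<Longrightarrow> \<phi> ` e \<subseteq> {q, r, s}"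
  shows star
proof (rule ccontr)
  assume ns: "\<not> star"
  have avoid: "\<exists>e\<in>edges H. x \<notin> \<phi> ` e" for x
    using starI[OF \<phi>] ns by blast
  have img: "\<exists>u v. {u, v} \<in> edges H \<and> u \<in> support \<and> v \<in> support \<and> \<phi> u = x \<and> \<phi> v = y"
    if xyz: "{x, y, z} = {q, r, s}" for x y z
  proof -
    obtain e where e: "e \<in> edges H" "z \<notin> \<phi> ` e"
      using avoid by blast
    obtain u v where uv: "e = {u, v}" "u \<noteq> v" "u \<in> support" "v \<in> support"
      using e(1) by (rule edgeE)
    then have "\<phi> u \<noteq> \<phi> v"
      using \<phi> unfolding embedding_def by (auto simp: inj_on_eq_iff)
    moreover have "\<phi> u \<in> {x, y}" "\<phi> v \<in> {x, y}"
      using sub[OF e(1)] e(2) uv(1) xyz by auto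
    ultimately have "\<phi> u = x \<and> \<phi> v = y \<or> \<phi> v = x \<and> \<phi> u = y"
      by auto
    then show ?thesis
      using uv e(1) by (metis insert_commute)
  qed
  obtain u v where uv: "{u, v} \<in> edges H" "u \<in> support" "v \<in> support" "\<phi> u = q" "\<phi> v = r"
    using img[of q r s] by auto
  obtain v' w where vw: "{v', w} \<in> edges H" "v' \<in> support" "w \<in> support" "\<phi> v' = r" "\<phi> w = s"
    using img[of r s q] by auto
  obtain u' w' where uw: "{u', w'} \<in> edges H" "u' \<in> support" "w' \<in> support" "\<phi> u' = q" "\<phi> w' = s"
    using img[of q s r] by auto
  have inj: "inj_on \<phi> support"
    using \<phi> unfolding embedding_def by simp
  have "v' = v" "u' = u" "w' = w"
    using inj_onD[OF inj] uv vw uw by simp_all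
  then have "\<kappa> u \<noteq> \<kappa> v" "\<kappa> v \<noteq> \<kappa> w" "\<kappa> u \<noteq> \<kappa> w" "\<kappa> u < 2" "\<kappa> v < 2" "\<kappa> w < 2"
    using coloring uv vw uw support_subset \<open>k = 2\<close> unfolding proper_vertex_coloring_def by auto
  then show False
    by linarith
qed

text \<open>The six edges on four vertices split into three stars, or, when \<open>H\<close> is bipartite and only
  three colours are available, into a star and a triangle.\<close>

lemma star_or_embedding_off_four:
  assumes "distinct [p, q, r, s]"
  shows "star \<or> (\<exists>\<phi>. embedding \<phi> \<and> (\<forall>e\<in>edges H. \<not> \<phi> ` e \<subseteq> {p, q, r, s}))"
proof -
  define c :: "nat set \<Rightarrow> nat" where
    "c e = (if \<not> e \<subseteq> {p, q, r, s} then 1 else if p \<in> e then 2 else if q \<in> e \<or> k = 2 then 3 else 4)" for e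
  define ms where "ms = (if k = 2 then [1, 2, 3] else [1, 2, 3, 4 :: nat])"
  have c_eq: "c e = 1 \<longleftrightarrow> \<not> e \<subseteq> {p, q, r, s}"
    "c e = 2 \<longleftrightarrow> e \<subseteq> {p, q, r, s} \<and> p \<in> e"
    "c e = 3 \<longleftrightarrow> e \<subseteq> {p, q, r, s} \<and> p \<notin> e \<and> (q \<in> e \<or> k = 2)"
    "c e = 4 \<longleftrightarrow> e \<subseteq> {p, q, r, s} \<and> p \<notin> e \<and> q \<notin> e \<and> k \<noteq> 2" for e
    unfolding c_def by (simp_all del: insert_subset subset_insert_iff)
  have ms: "c e \<in> set ms" for e
    by (simp add: c_def ms_def)
  have "length ms \<le> k + 1"
    using two_le_k by (simp add: ms_def)
  then obtain \<phi> m where \<phi>: "embedding \<phi>" and m: "m \<in> set ms"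
    and c: "\<And>e. e \<in> edges H \<Longrightarrow> c (\<phi> ` e) = m"
    by (rule recoloring[of c ms, OF ms]) blast
  have cases: "m = 1 \<or> m = 2 \<or> m = 3 \<or> m = 4"
    using m by (auto simp: ms_def split: if_splits)
  consider "m = 1" | "m = 2" | "m = 3" "k = 2" | "m = 3" "k \<noteq> 2" | "m = 4"
    using cases by blast
  then show ?thesis
  proof cases
    case 1
    then have "\<not> \<phi> ` e \<subseteq> {p, q, r, s}" if "e \<in> edges H" for e
      using c[OF that] c_eq(1)[of "\<phi> ` e"] by metis
    then show ?thesis
      using \<phi> by blast
  next
    case 2
    then have "p \<in> \<phi> ` e" if "e \<in> edges H" for e
      using c[OF that] c_eq(2)[of "\<phi> ` e"] by metis
    then show ?thesis
      using starI[OF \<phi>] by blast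
  next
    case 3
    then have "\<phi> ` e \<subseteq> {p, q, r, s}" "p \<notin> \<phi> ` e" if "e \<in> edges H" for e
      using c[OF that] c_eq(3)[of "\<phi> ` e"] by metis+
    then have "\<phi> ` e \<subseteq> {q, r, s}" if "e \<in> edges H" for e
      using that by blast
    then show ?thesis
      using bipartite_in_triangle_star[OF 3(2) \<phi>, of q r s] assms by auto
  next
    case 4
    then have "q \<in> \<phi> ` e" if "e \<in> edges H" for e
      using c[OF that] c_eq(3)[of "\<phi> ` e"] by metis
    then show ?thesis
      using starI[OF \<phi>] by blast
  next
    case 5
    have "r \<in> \<phi> ` e" if e: "e \<in> edges H" for e
    proof -
      have "\<phi> ` e \<subseteq> {r, s}"
        using c[OF e] 5 c_eq(4)[of "\<phi> ` e"] by auto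
      moreover obtain x y where "\<phi> ` e = {x, y}" "x \<noteq> y"
        using embedding_edge[OF \<phi> e] by (rule nsets2_E)
      ultimately show ?thesis
        by auto
    qed
    then show ?thesis
      using starI[OF \<phi>] by blast
  qed
qed

text \<open>On at most five vertices every edge not inside \<open>{0, 1, 2, 3}\<close> contains 4,
  so a copy made of such edges is a star.\<close>

lemma star_if_small:
  assumes "N \<le> 5"
  shows star
proof -
  have "star \<or> (\<exists>\<phi>. embedding \<phi> \<and> (\<forall>e\<in>edges H. \<not> \<phi> ` e \<subseteq> {0, 1, 2, 3}))"
    by (rule star_or_embedding_off_four) simp
  then show ?thesis
  proof
    assume "\<exists>\<phi>. embedding \<phi> \<and> (\<forall>e\<in>edges H. \<not> \<phi> ` e \<subseteq> {0, 1, 2, 3})"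
    then obtain \<phi> where \<phi>: "embedding \<phi>" and off: "\<And>e. e \<in> edges H \<Longrightarrow> \<not> \<phi> ` e \<subseteq> {0, 1, 2, 3}"
      by blast
    have "4 \<in> \<phi> ` e" if e: "e \<in> edges H" for e
    proof -
      have "\<phi> ` e \<subseteq> {..<N}"
        using embedding_edge[OF \<phi> e] by (auto simp: nsets_def)
      also have "\<dots> \<subseteq> {0, 1, 2, 3, 4}"
        using assms by auto
      finally have "\<phi> ` e \<subseteq> {0, 1, 2, 3, 4}" .
      moreover obtain x where "x \<in> \<phi> ` e" "x \<notin> {0, 1, 2, 3}"
        using off[OF e] by (meson subsetI)
      ultimately have "x = 4"
        by auto
      then show ?thesis
        using \<open>x \<in> \<phi> ` e\<close> by simp
    qed
    then show star
      by (rule starI[OF \<phi>])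
  qed
qed

text \<open>The centre of the star has a neighbour in colour \<open>m\<close> for each leaf, so a
  bound \<open>d\<close> on the degrees in that colour bounds the support.\<close>

lemma star_monochromatic_neighbourhood:
  fixes c :: "nat set \<Rightarrow> 'c"
  assumes star and "embedding \<phi>" and "\<And>e. e \<in> edges H \<Longrightarrow> c (\<phi> ` e) = m"
    and "\<And>x D. x < N \<Longrightarrow> D \<subseteq> {y. y < N \<and> y \<noteq> x \<and> c {x, y} = m} \<Longrightarrow> card D \<le> d"
  shows "card support \<le> d + 1"
proof -
  obtain z where z: "z \<in> support" "\<And>e. e \<in> edges H \<Longrightarrow> z \<in> e"
    using \<open>star\<close> unfolding star_def by blast
  have \<phi>: "inj_on \<phi> support" "\<phi> ` support \<subseteq> {..<N}"
    using assms(2) unfolding embedding_def by auto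
  have "\<phi> ` (support - {z}) \<subseteq> {y. y < N \<and> y \<noteq> \<phi> z \<and> c {\<phi> z, y} = m}"
  proof
    fix y
    assume "y \<in> \<phi> ` (support - {z})"
    then obtain u where u: "u \<in> support" "u \<noteq> z" "y = \<phi> u"
      by blast
    then obtain e where e: "e \<in> edges H" "u \<in> e"
      unfolding support_def by blast
    obtain a b where "e = {a, b}"
      using e(1) by (rule edgeE)
    then have "e = {z, u}"
      using z(2)[OF e(1)] e(2) u(2) by auto
    then have "c {\<phi> z, y} = m"
      using assms(3)[OF e(1)] u(3) by simp
    then show "y \<in> {y. y < N \<and> y \<noteq> \<phi> z \<and> c {\<phi> z, y} = m}"
      using \<phi> u z(1) by (auto simp: inj_on_eq_iff)
  qed
  then have "card (\<phi> ` (support - {z})) \<le> d"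
    using assms(4)[of "\<phi> z"] \<phi>(2) z(1) by auto
  moreover have "card (\<phi> ` (support - {z})) = card support - 1"
    using \<phi>(1) z(1) finite_support by (subst card_image) (auto intro: inj_on_subset)
  ultimately show ?thesis
    by linarith
qed

text \<open>The test colouring splits \<open>K\<^sub>4\<close> into its three perfect matchings. In
  each of them degrees are at most 1, so the star \<open>H\<close> has a single edge.\<close>

lemma card_support_le_two:
  assumes "N \<le> 4"
  shows "card support \<le> 2"
proof -
  define c :: "nat set \<Rightarrow> nat" where
    "c e = (if e = {0, 1} \<or> e = {2, 3} then 0 else if e = {0, 2} \<or> e = {1, 3} then 2 else 3)" for e
  have inj: "y = z" if "x < 4" "y < 4" "z < 4" "y \<noteq> x" "z \<noteq> x" "c {x, y} = c {x, z}" for x y z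
  proof -
    have "x = 0 \<or> x = 1 \<or> x = 2 \<or> x = 3" "y = 0 \<or> y = 1 \<or> y = 2 \<or> y = 3"
      "z = 0 \<or> z = 1 \<or> z = 2 \<or> z = 3"
      using that(1-3) by auto
    then show ?thesis
      using that(4-6) by (elim disjE) (simp_all add: c_def doubleton_eq_iff)
  qed
  have "c e \<in> set [0, 2, 3]" for e
    by (simp add: c_def)
  then obtain \<phi> m where \<phi>: "embedding \<phi>" and c: "\<And>e. e \<in> edges H \<Longrightarrow> c (\<phi> ` e) = m"
    using two_le_k by (rule_tac recoloring[of c "[0, 2, 3]"]) auto
  have "card D \<le> 1" if "x < N" "D \<subseteq> {y. y < N \<and> y \<noteq> x \<and> c {x, y} = m}" for x D
  proof -
    have "finite D"
      using that(2) by (rule finite_subset) auto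
    moreover have "y = z" if "y \<in> D" "z \<in> D" for y z
    proof (rule inj[of x])
      show "x < 4" "y < 4" "z < 4" "y \<noteq> x" "z \<noteq> x" "c {x, y} = c {x, z}"
        using \<open>x < N\<close> assms subsetD[OF \<open>D \<subseteq> _\<close> that(1)] subsetD[OF \<open>D \<subseteq> _\<close> that(2)] by simp_all
    qed
    ultimately show ?thesis
      by (simp add: card_le_Suc0_iff_eq)
  qed
  then have "card support \<le> 1 + 1"
    using star_monochromatic_neighbourhood[where c = c and m = m and d = 1 and \<phi> = \<phi>]
      star_if_small assms \<phi> c by simp
  then show ?thesis
    by simp
qed

text \<open>The edges of \<open>K\<^sub>5\<close> decompose into two 5-cycles.\<close>

lemma card_support_le_three:
  assumes "N = 5"
  shows "card support \<le> 3"
proof -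
  define c :: "nat set \<Rightarrow> nat" where "c e = (if \<exists>x\<in>e. (x + 1) mod 5 \<in> e then 0 else 2)" for e
  have "c e \<in> set [0, 2]" for e
    by (simp add: c_def)
  then obtain \<phi> m where \<phi>: "embedding \<phi>" and c: "\<And>e. e \<in> edges H \<Longrightarrow> c (\<phi> ` e) = m"
    using two_le_k by (rule_tac recoloring[of c "[0, 2]"]) auto
  have "card D \<le> 2" if "x < N" "D \<subseteq> {y. y < N \<and> y \<noteq> x \<and> c {x, y} = m}" for x D
  proof -
    have xy: "(c {x, y} = 0 \<longrightarrow> y = (x + 1) mod 5 \<or> y = (x + 4) mod 5) \<and>
        (c {x, y} \<noteq> 0 \<longrightarrow> y = (x + 2) mod 5 \<or> y = (x + 3) mod 5)" if "y < N" "y \<noteq> x" for y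
    proof -
      have "x = 0 \<or> x = 1 \<or> x = 2 \<or> x = 3 \<or> x = 4" "y = 0 \<or> y = 1 \<or> y = 2 \<or> y = 3 \<or> y = 4"
        using that \<open>x < N\<close> assms by auto
      then show ?thesis
        using that(2) by (elim disjE) (simp_all add: c_def)
    qed
    have "D \<subseteq> {(x + 1) mod 5, (x + 4) mod 5} \<or> D \<subseteq> {(x + 2) mod 5, (x + 3) mod 5}"
    proof (cases "m = 0")
      case True
      then have "D \<subseteq> {(x + 1) mod 5, (x + 4) mod 5}"
        using xy that(2) by blast
      then show ?thesis ..
    next
      case False
      then have "D \<subseteq> {(x + 2) mod 5, (x + 3) mod 5}"
        using xy that(2) by blast
      then show ?thesis ..
    qed
    moreover have "card {a, b} \<le> 2" for a b :: nat
      by (simp add: card_insert_if)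
    ultimately show ?thesis
      by (meson card_mono finite.emptyI finite_insert order_trans)
  qed
  then have "card support \<le> 2 + 1"
    using star_monochromatic_neighbourhood[where c = c and m = m and d = 2 and \<phi> = \<phi>]
      star_if_small assms \<phi> c by simp
  then show ?thesis
    by simp
qed

section \<open>Few vertices and nearly monochromatic colourings\<close>

lemma monochromatic_if_at_most_four:
  assumes "N \<le> 4"
  shows "contains_monochromatic c"
proof -
  obtain \<phi> where "\<phi> ` support \<subseteq> {..<N}" "inj_on \<phi> support"
    using card_le_inj[OF finite_support, of "{..<N}"] card_support_le by auto
  then have "embedding \<phi>"
    unfolding embedding_def by blast
  moreover have "e = support" if e: "e \<in> edges H" for e
  proof (rule card_seteq[OF finite_support])
    show "e \<subseteq> support"
      using e unfolding support_def by blast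
    obtain u v where "e = {u, v}" "u \<noteq> v"
      using e by (rule edgeE)
    then show "card support \<le> card e"
      using card_support_le_two[OF assms] by simp
  qed
  ultimately show ?thesis
    unfolding contains_monochromatic_def by metis
qed

text \<open>A star gets a centre outside \<open>{a, b, d}\<close>, which sees all vertices but
  \<open>a\<close> in colour \<open>m\<close>. Otherwise the support has at most
  \<open>N - 2\<close> vertices and fits into the clique left after deleting \<open>a\<close> and
  \<open>b\<close>.\<close>

lemma monochromatic_if_near:
  assumes "6 \<le> N" and abd: "{a, b, d} \<subseteq> {..<N}" "distinct [a, b, d]"
    and m: "\<And>x y. x \<in> {..<N} - {a} \<Longrightarrow> y \<in> {..<N} - {a} \<Longrightarrow> x \<noteq> y \<Longrightarrow> {x, y} \<noteq> {b, d} \<Longrightarrow>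
      c {x, y} = m"
  shows "contains_monochromatic c"
proof (cases star)
  case True
  have "card {a, b, d} \<le> 3"
    using card_length[of "[a, b, d]"] by simp
  then have "\<not> {..<N} \<subseteq> {a, b, d}"
    using assms(1) card_mono[of "{a, b, d}" "{..<N}"] by auto
  then obtain x where x: "x < N" "x \<notin> {a, b, d}"
    by blast
  have card: "card ({..<N} - {a, x}) = N - 2"
    using x abd by (subst card_Diff_subset) auto
  show ?thesis
  proof (rule embed_star[OF True x(1), where D = "{..<N} - {a, x}" and m = m])
    show "card support \<le> card ({..<N} - {a, x}) + 1"
      using card_support_less assms(1) card by simp
    show "c {x, y} = m" if "y \<in> {..<N} - {a, x}" for y
      using m[of x y] that x by (auto simp: doubleton_eq_iff)
  qed auto
next
  case False
  have card: "card ({..<N} - {a, b}) = N - 2"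
    using abd by (subst card_Diff_subset) auto
  show ?thesis
  proof (rule embed_in_clique[where W = "{..<N} - {a, b}" and m = m])
    show "card support \<le> card ({..<N} - {a, b})"
      using star_or_card_support False assms(1) card by simp
    show "c {x, y} = m" if "x \<in> {..<N} - {a, b}" "y \<in> {..<N} - {a, b}" "x \<noteq> y" for x y
      using m[of x y] that by (auto simp: doubleton_eq_iff)
  qed auto
qed

text \<open>A star gets a centre outside the four vertices, where all edges have colour
  \<open>m\<close>; any other \<open>H\<close> embeds without an edge inside them.\<close>

lemma monochromatic_if_off_four:
  assumes "5 \<le> N" "distinct [p, q, r, s]"
    and m: "\<And>x y. x < N \<Longrightarrow> y < N \<Longrightarrow> x \<noteq> y \<Longrightarrow> \<not> {x, y} \<subseteq> {p, q, r, s} \<Longrightarrow> c {x, y} = m"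
  shows "contains_monochromatic c"
proof (cases star)
  case True
  have "card {p, q, r, s} \<le> 4"
    using card_length[of "[p, q, r, s]"] by simp
  then have "\<not> {..<N} \<subseteq> {p, q, r, s}"
    using assms(1) card_mono[of "{p, q, r, s}" "{..<N}"] by auto
  then obtain x where x: "x < N" "x \<notin> {p, q, r, s}"
    by blast
  show ?thesis
  proof (rule embed_star[OF True x(1), where D = "{..<N} - {x}" and m = m])
    show "card support \<le> card ({..<N} - {x}) + 1"
      using card_support_le x by simp
    show "c {x, y} = m" if "y \<in> {..<N} - {x}" for y
      using m[of x y] that x by blast
  qed auto
next
  case False
  then obtain \<phi> where \<phi>: "embedding \<phi>" and off: "\<And>e. e \<in> edges H \<Longrightarrow> \<not> \<phi> ` e \<subseteq> {p, q, r, s}"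
    using star_or_embedding_off_four[OF assms(2)] by blast
  have "c (\<phi> ` e) = m" if e: "e \<in> edges H" for e
  proof -
    obtain x y where "\<phi> ` e = {x, y}" "x \<in> {..<N}" "y \<in> {..<N}" "x \<noteq> y"
      using embedding_edge[OF \<phi> e] by (rule nsets2_E)
    then show ?thesis
      using m[of x y] off[OF e] by simp
  qed
  then show ?thesis
    using \<phi> unfolding contains_monochromatic_def by blast
qed

section \<open>Dominant colours\<close>

lemma two_mult_card_class_le:
  assumes "i \<noteq> j" "card {u \<in> support. \<kappa> u = i} \<le> card {u \<in> support. \<kappa> u = j}"
  shows "2 * card {u \<in> support. \<kappa> u = i} \<le> card support"
proof -
  have "card {u \<in> support. \<kappa> u = i} + card {u \<in> support. \<kappa> u = j}
      = card ({u \<in> support. \<kappa> u = i} \<union> {u \<in> support. \<kappa> u = j})"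
    using assms(1) finite_support by (subst card_Un_disjoint) auto
  also have "\<dots> \<le> card support"
    using finite_support by (intro card_mono) auto
  finally show ?thesis
    using assms(2) by simp
qed

section \<open>Blocks of a labelling and their merging\<close>

text \<open>Blocks are encoded as fibres of a labelling, so that merging two of them is a
  relabelling.\<close>

definition block :: "(nat \<Rightarrow> nat) \<Rightarrow> nat \<Rightarrow> nat set" where
  "block g l = {v. v < N \<and> g v = l}"

text \<open>The second condition guarantees that a copy of \<open>H\<close> formed inside one block
  by edges of colours other than \<open>m\<close> is monochromatic: either the block is too small
  for a copy, or these edges have one colour.\<close>

definition admissible :: "(nat set \<Rightarrow> nat) \<Rightarrow> nat \<Rightarrow> (nat \<Rightarrow> nat) \<Rightarrow> bool" where
  "admissible c m g \<longleftrightarrow>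
     (\<forall>x<N. \<forall>y<N. x \<noteq> y \<longrightarrow> c {x, y} \<noteq> m \<longrightarrow> g x = g y) \<and>
     (\<forall>l. card (block g l) < card support \<or>
       (\<exists>j. \<forall>x\<in>block g l. \<forall>y\<in>block g l. x \<noteq> y \<longrightarrow> c {x, y} \<noteq> m \<longrightarrow> c {x, y} = j))"

lemma finite_block: "finite (block g l)"
  unfolding block_def by simp

lemma block_disjoint: "l \<noteq> l' \<Longrightarrow> block g l \<inter> block g l' = {}"
  unfolding block_def by auto

lemma card_support_pos: "0 < card support"
proof -
  obtain u v where "{u, v} \<in> edges H" "u \<in> support"
    by (rule ex_edge)
  then show ?thesis
    using finite_support by (auto simp: card_gt_0_iff)
qed

lemma ex_admissible:
  assumes dom: "\<And>v p q. v < N \<Longrightarrow> p < N \<Longrightarrow> q < N \<Longrightarrow> p \<noteq> v \<Longrightarrow> q \<noteq> v \<Longrightarrow>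
    c {v, p} \<noteq> m \<Longrightarrow> c {v, q} \<noteq> m \<Longrightarrow> c {v, p} = c {v, q}"
  obtains g where "admissible c m g"
proof -
  define P where "P v p \<longleftrightarrow> p < N \<and> p \<noteq> v \<and> c {v, p} \<noteq> m" for v p
  define J where "J v = c {v, SOME p. P v p}" for v
  have J: "J v = c {v, p}" if "v < N" "P v p" for v p
    using someI[of "P v" p] dom[of v "SOME p. P v p" p] that unfolding J_def P_def by auto
  \<comment> \<open>A vertex meeting a colour other than \<open>m\<close> gets twice that colour as
    its label; the others get distinct odd labels and form singleton blocks. Halving an even label
    recovers the colour.\<close>
  define g where "g v = (if \<exists>p. P v p then 2 * J v else 2 * v + 1)" for v
  have g: "g x = 2 * c {x, y}" "g y = 2 * c {x, y}" if "x < N" "y < N" "x \<noteq> y" "c {x, y} \<noteq> m" for x y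
  proof -
    have P: "P x y" "P y x"
      using that unfolding P_def by (auto simp: insert_commute)
    then show "g x = 2 * c {x, y}" "g y = 2 * c {x, y}"
      using J[OF that(1) P(1)] J[OF that(2) P(2)] unfolding g_def by (auto simp: insert_commute)
  qed
  have "admissible c m g"
    unfolding admissible_def
  proof (intro conjI allI impI)
    show "g x = g y" if "x < N" "y < N" "x \<noteq> y" "c {x, y} \<noteq> m" for x y
      using g[OF that] by simp
    have "c {x, y} = l div 2" if "x \<in> block g l" "y \<in> block g l" "x \<noteq> y" "c {x, y} \<noteq> m" for l x y
      using g(1)[of x y] that unfolding block_def by auto
    then show "card (block g l) < card support \<or>
        (\<exists>j. \<forall>x\<in>block g l. \<forall>y\<in>block g l. x \<noteq> y \<longrightarrow> c {x, y} \<noteq> m \<longrightarrow> c {x, y} = j)" for l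
      by blast
  qed
  then show ?thesis
    by (rule that)
qed

text \<open>The merged block may contain several colours besides \<open>m\<close>, but it stays too
  small for a copy of \<open>H\<close>.\<close>

lemma admissible_merge:
  assumes "admissible c m g" "l \<noteq> l'" "card (block g l) + card (block g l') < card support"
  shows "admissible c m (\<lambda>v. if g v = l' then l else g v)" (is "admissible c m ?g")
  unfolding admissible_def
proof (intro conjI allI impI)
  show "?g x = ?g y" if "x < N" "y < N" "x \<noteq> y" "c {x, y} \<noteq> m" for x y
    using assms(1) that unfolding admissible_def by metis
  fix i
  consider "i = l" | "i = l'" | "i \<noteq> l" "i \<noteq> l'"
    by blast
  then show "card (block ?g i) < card support \<or>
      (\<exists>j. \<forall>x\<in>block ?g i. \<forall>y\<in>block ?g i. x \<noteq> y \<longrightarrow> c {x, y} \<noteq> m \<longrightarrow> c {x, y} = j)"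
  proof cases
    case 1
    then have "block ?g i = block g l \<union> block g l'"
      unfolding block_def by auto
    then have "card (block ?g i) = card (block g l) + card (block g l')"
      using block_disjoint[OF assms(2)] finite_block by (simp add: card_Un_disjoint)
    then show ?thesis
      using assms(3) by simp
  next
    case 2
    then have "block ?g i = {}"
      using assms(2) unfolding block_def by auto
    then show ?thesis
      using card_support_pos by simp
  next
    case 3
    then have "block ?g i = block g i"
      unfolding block_def by auto
    then show ?thesis
      using assms(1) unfolding admissible_def by simp
  qed
qed

text \<open>A labelling with the fewest labels is chosen; two blocks with too few vertices together
  could be merged to save a label.\<close>

lemma ex_minimal_admissible:
  assumes "admissible c m g0"
  obtains g where "admissible c m g"
    "\<And>l l'. l \<in> g ` {..<N} \<Longrightarrow> l' \<in> g ` {..<N} \<Longrightarrow> l \<noteq> l' \<Longrightarrow>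
      card support \<le> card (block g l) + card (block g l')"
proof -
  obtain g where adm: "admissible c m g"
    and min: "\<And>g'. admissible c m g' \<Longrightarrow> card (g ` {..<N}) \<le> card (g' ` {..<N})"
    using ex_has_least_nat[of "admissible c m" g0 "\<lambda>g. card (g ` {..<N})"] assms by blast
  have "card support \<le> card (block g l) + card (block g l')"
    if l: "l \<in> g ` {..<N}" "l' \<in> g ` {..<N}" "l \<noteq> l'" for l l'
  proof (rule ccontr)
    assume "\<not> ?thesis"
    then have "admissible c m (\<lambda>v. if g v = l' then l else g v)" (is "admissible c m ?g")
      using admissible_merge[OF adm l(3)] by simp
    then have "card (g ` {..<N}) \<le> card (?g ` {..<N})"
      by (rule min)
    also have "\<dots> \<le> card (g ` {..<N} - {l'})"
      using l by (intro card_mono) auto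
    also have "\<dots> < card (g ` {..<N})"
      using l(2) by (intro card_Diff1_less) auto
    finally show False
      by simp
  qed
  then show ?thesis
    using that adm by blast
qed

text \<open>One colour for \<open>m\<close> and one for each block make at most
  \<open>k + 1\<close>. A copy in the colour of a block occupies \<open>card support\<close> of its
  vertices, so admissibility leaves only one original colour on it.\<close>

lemma monochromatic_if_few_blocks:
  assumes adm: "admissible c m g" and few: "card (g ` {..<N}) \<le> k"
  shows "contains_monochromatic c"
proof -
  \<comment> \<open>\<open>Min e\<close> selects an endpoint; if the colour of the edge is not
    \<open>m\<close>, both endpoints have the same label.\<close>
  define c' where "c' e = (if c e = m then 0 else Suc (g (Min e)))" for e
  have "c' ` [{..<N}]\<^bsup>2\<^esup> \<subseteq> insert 0 (Suc ` g ` {..<N})"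
  proof
    fix i
    assume "i \<in> c' ` [{..<N}]\<^bsup>2\<^esup>"
    then obtain e where e: "e \<in> [{..<N}]\<^bsup>2\<^esup>" "i = c' e"
      by blast
    then have "finite e" "e \<noteq> {}" "e \<subseteq> {..<N}"
      by (auto simp: nsets_def)
    then have "Min e \<in> {..<N}"
      using Min_in by blast
    then show "i \<in> insert 0 (Suc ` g ` {..<N})"
      using e(2) unfolding c'_def by auto
  qed
  then have "card (c' ` [{..<N}]\<^bsup>2\<^esup>) \<le> card (insert 0 (Suc ` g ` {..<N}))"
    by (intro card_mono) auto
  also have "\<dots> \<le> k + 1"
    using few by (simp add: card_insert_if card_image)
  finally obtain \<phi> i where \<phi>: "embedding \<phi>" and i: "\<And>e. e \<in> edges H \<Longrightarrow> c' (\<phi> ` e) = i"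
    using few_colors unfolding contains_monochromatic_def by metis
  show ?thesis
  proof (cases i)
    case 0
    then have "c (\<phi> ` e) = m" if "e \<in> edges H" for e
      using i[OF that] unfolding c'_def by (metis nat.distinct(1))
    then show ?thesis
      using \<phi> unfolding contains_monochromatic_def by blast
  next
    case (Suc l)
    have edge: "c (\<phi> ` e) \<noteq> m \<and> \<phi> ` e \<subseteq> block g l" if e: "e \<in> edges H" for e
    proof -
      have c: "c (\<phi> ` e) \<noteq> m" "g (Min (\<phi> ` e)) = l"
        using i[OF e] Suc unfolding c'_def by (auto split: if_splits)
      obtain x y where xy: "\<phi> ` e = {x, y}" "x \<in> {..<N}" "y \<in> {..<N}" "x \<noteq> y"
        using embedding_edge[OF \<phi> e] by (rule nsets2_E)
      then have "g x = g y"
        using adm c(1) unfolding admissible_def by auto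
      moreover have "Min {x, y} = x \<or> Min {x, y} = y"
        by (simp add: min_def)
      ultimately show ?thesis
        using c xy unfolding block_def by auto
    qed
    then have "\<phi> ` support \<subseteq> block g l"
      unfolding support_def by blast
    then have "card support \<le> card (block g l)"
      using card_mono[OF finite_block] embedding_support_card[OF \<phi>] by metis
    then obtain j where j: "\<And>x y. x \<in> block g l \<Longrightarrow> y \<in> block g l \<Longrightarrow> x \<noteq> y \<Longrightarrow>
        c {x, y} \<noteq> m \<Longrightarrow> c {x, y} = j"
      using adm unfolding admissible_def by (meson linorder_not_less)
    have "c (\<phi> ` e) = j" if e: "e \<in> edges H" for e
    proof -
      obtain x y where "\<phi> ` e = {x, y}" "x \<noteq> y"
        using embedding_edge[OF \<phi> e] by (rule nsets2_E)
      then show ?thesis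
        using edge[OF e] j[of x y] by simp
    qed
    then show ?thesis
      using \<phi> unfolding contains_monochromatic_def by blast
  qed
qed

text \<open>Any two blocks together have at least as many vertices as the support of \<open>H\<close>, so all blocks
  but one have at least half as many. Hence the largest colour class of \<open>H\<close> fits into the union of two
  blocks, and each other class, having at most half of the vertices, fits into one of the rest.\<close>

lemma monochromatic_if_many_blocks:
  assumes adm: "admissible c m g" and many: "k < card (g ` {..<N})"
    and two: "\<And>l l'. l \<in> g ` {..<N} \<Longrightarrow> l' \<in> g ` {..<N} \<Longrightarrow> l \<noteq> l' \<Longrightarrow>
      card support \<le> card (block g l) + card (block g l')"
  shows "contains_monochromatic c"
proof -
  let ?A = "\<lambda>i. {u \<in> support. \<kappa> u = i}"
  let ?L = "g ` {..<N}"
  have "Max ((\<lambda>i. card (?A i)) ` {..<k}) \<in> (\<lambda>i. card (?A i)) ` {..<k}"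
    using two_le_k by (intro Max_in) (auto simp: lessThan_empty_iff)
  then obtain i0 where "i0 < k" and "card (?A i0) = Max ((\<lambda>i. card (?A i)) ` {..<k})"
    by auto
  then have i0: "i0 < k" "\<And>i. i < k \<Longrightarrow> card (?A i) \<le> card (?A i0)"
    by auto
  have "?L \<noteq> {}"
    using many by auto
  then obtain l1 where l1: "l1 \<in> ?L" "\<And>l. l \<in> ?L \<Longrightarrow> card (block g l1) \<le> card (block g l)"
    using ex_has_least_nat[of "\<lambda>l. l \<in> ?L" _ "\<lambda>l. card (block g l)"] by blast
  have "card (?L - {l1}) \<ge> 1"
    using l1(1) many two_le_k by simp
  then obtain l2 where l2: "l2 \<in> ?L" "l2 \<noteq> l1"
    by (metis DiffE all_not_in_conv card.empty insertI1 not_one_le_zero)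
  have half: "card support \<le> 2 * card (block g l)" if "l \<in> ?L" "l \<noteq> l1" for l
    using two[OF that(1) l1(1) that(2)] l1(2)[OF that(1)] by simp
  \<comment> \<open>The \<open>k - 1\<close> other classes need blocks besides \<open>l1\<close> and
    \<open>l2\<close>, and at least \<open>k + 1 - 2\<close> of these are left.\<close>
  have "card ({..<k} - {i0}) \<le> card (?L - {l1, l2})"
    using i0(1) l1(1) l2 many by (simp add: card_Diff_subset)
  then obtain \<sigma> where \<sigma>: "\<sigma> ` ({..<k} - {i0}) \<subseteq> ?L - {l1, l2}" "inj_on \<sigma> ({..<k} - {i0})"
    using card_le_inj[of "{..<k} - {i0}" "?L - {l1, l2}"] by auto
  define lab where "lab i = (if i = i0 then {l1, l2} else {\<sigma> i})" for i
  define T where "T i = {v. v < N \<and> g v \<in> lab i}" for i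
  have lab: "lab i \<inter> lab j = {}" if ij: "i < k" "j < k" "i \<noteq> j" for i j
  proof -
    have "\<sigma> i \<noteq> \<sigma> j" if "i \<noteq> i0" "j \<noteq> i0"
      using inj_onD[OF \<sigma>(2)] that ij by auto
    moreover have "\<sigma> i \<notin> {l1, l2}" if "i < k" "i \<noteq> i0" for i
      using \<sigma>(1) that by auto
    ultimately show ?thesis
      using ij unfolding lab_def by auto
  qed
  show ?thesis
  proof (rule embed_multipartite[where T = T and m = m])
    show "T i \<subseteq> {..<N}" for i
      unfolding T_def by auto
    show "card (?A i) \<le> card (T i)" if "i < k" for i
    proof (cases "i = i0")
      case True
      then have "T i = block g l1 \<union> block g l2"
        unfolding T_def lab_def block_def by auto
      then have "card (T i) = card (block g l1) + card (block g l2)"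
        using block_disjoint[of l1 l2 g] l2(2) finite_block by (simp add: card_Un_disjoint)
      moreover have "card (?A i) \<le> card support"
        using finite_support by (intro card_mono) auto
      ultimately show ?thesis
        using two[OF l2(1) l1(1) l2(2)] by simp
    next
      case False
      then have "T i = block g (\<sigma> i)"
        unfolding T_def lab_def block_def by auto
      moreover have "\<sigma> i \<in> ?L" "\<sigma> i \<noteq> l1"
        using \<sigma>(1) False that by auto
      ultimately show ?thesis
        using half[of "\<sigma> i"] two_mult_card_class_le[OF False i0(2)[OF that]] by simp
    qed
    show "T i \<inter> T j = {}" if "i < k" "j < k" "i \<noteq> j" for i j
      using lab[OF that] unfolding T_def by auto
    show "c {x, y} = m" if "i < k" "j < k" "i \<noteq> j" "x \<in> T i" "y \<in> T j" for i j x y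
    proof -
      have "g x \<noteq> g y"
        using lab[OF that(1-3)] that(4,5) unfolding T_def by auto
      then show ?thesis
        using adm that(4,5) unfolding admissible_def T_def by blast
    qed
  qed
qed

lemma monochromatic_if_dominant:
  fixes c :: "nat set \<Rightarrow> nat"
  assumes "\<And>v p q. v < N \<Longrightarrow> p < N \<Longrightarrow> q < N \<Longrightarrow> p \<noteq> v \<Longrightarrow> q \<noteq> v \<Longrightarrow>
    c {v, p} \<noteq> m \<Longrightarrow> c {v, q} \<noteq> m \<Longrightarrow> c {v, p} = c {v, q}"
  shows "contains_monochromatic c"
proof -
  obtain g0 where "admissible c m g0"
    by (rule ex_admissible[of c m, OF assms])
  then obtain g where g: "admissible c m g"
    and two: "\<And>l l'. l \<in> g ` {..<N} \<Longrightarrow> l' \<in> g ` {..<N} \<Longrightarrow> l \<noteq> l' \<Longrightarrow>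
      card support \<le> card (block g l) + card (block g l')"
    by (rule ex_minimal_admissible) blast
  show ?thesis
  proof (cases "card (g ` {..<N}) \<le> k")
    case True
    with g show ?thesis
      by (rule monochromatic_if_few_blocks)
  next
    case False
    then show ?thesis
      using monochromatic_if_many_blocks[OF g _ two] by simp
  qed
qed

end

section \<open>The bound\<close>

lemma rainbow_P5_copy:
  fixes c :: "nat set \<Rightarrow> nat"
  assumes V: "{v0, v1, v2, v3, v4} \<subseteq> {..<n}" "distinct [v0, v1, v2, v3, v4]"
    and col: "distinct [c {v0, v1}, c {v1, v2}, c {v2, v3}, c {v3, v4}]"
  shows "\<exists>K. is_copy_in K (path_graph 5) (complete_graph n) \<and> rainbow_graph c K"
proof -
  let ?l = "[v0, v1, v2, v3, v4]"
  let ?E = "{{v0, v1}, {v1, v2}, {v2, v3}, {v3, v4}}"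
  let ?K = "(set ?l, ?E)"
  have "{i. Suc i < 5} = {0, 1, 2, 3}"
    by auto
  then have "edges (path_graph 5) = {{0, 1}, {1, 2}, {2, 3}, {3, 4}}"
    unfolding path_graph_def by (simp add: setcompr_eq_image numeral_eq_Suc)
  then have "edges ?K = (\<lambda>e. (!) ?l ` e) ` edges (path_graph 5)"
    by (simp add: numeral_eq_Suc)
  moreover have "bij_betw ((!) ?l) (verts (path_graph 5)) (verts ?K)"
    using bij_betw_nth[OF V(2), of "{..<5}" "set ?l"] unfolding path_graph_def by simp
  ultimately have "graph_iso (path_graph 5) ?K"
    unfolding graph_iso_def by blast
  moreover have "subgraph ?K (complete_graph n)"
    using V unfolding subgraph_def complete_graph_def by simp
  moreover have "rainbow_graph c ?K"
    using col unfolding rainbow_graph_def by auto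
  ultimately show ?thesis
    unfolding is_copy_in_def by blast
qed

lemma (in ramsey_graph) monochromatic_or_rainbow:
  fixes c :: "nat set \<Rightarrow> nat"
  assumes no_rainbow: "\<not> (\<exists>K. is_copy_in K (path_graph 5) (complete_graph N) \<and> rainbow_graph c K)"
  shows "contains_monochromatic c"
proof (cases "N \<le> 4 \<or> card (c ` [{..<N}]\<^bsup>2\<^esup>) \<le> k + 1")
  case True
  then show ?thesis
    using monochromatic_if_at_most_four few_colors by blast
next
  case False
  interpret P: rainbow_P5_free "{..<N}" "\<lambda>x y. c {x, y}"
  proof
    show "5 \<le> card {..<N}"
      using False by simp
    show "c {x, y} = c {y, x}" for x y
      by (simp add: insert_commute)
    show "\<not> distinct [c {v0, v1}, c {v1, v2}, c {v2, v3}, c {v3, v4}]"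
      if "{v0, v1, v2, v3, v4} \<subseteq> {..<N}" "distinct [v0, v1, v2, v3, v4]" for v0 v1 v2 v3 v4
      using rainbow_P5_copy[OF that] no_rainbow by blast
  qed
  \<comment> \<open>More than \<open>k + 1\<close> colours occur and \<open>k\<close> is at least 2,
    so no three colours cover all edges.\<close>
  have many: "\<exists>x\<in>{..<N}. \<exists>y\<in>{..<N}. x \<noteq> y \<and> c {x, y} \<notin> {i, j, l}" for i j l
  proof -
    have "card {i, j, l} < card (c ` [{..<N}]\<^bsup>2\<^esup>)"
      using card_length[of "[i, j, l]"] False two_le_k by simp
    then have "\<not> c ` [{..<N}]\<^bsup>2\<^esup> \<subseteq> {i, j, l}"
      using card_mono[of "{i, j, l}" "c ` [{..<N}]\<^bsup>2\<^esup>"] by auto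
    then obtain e where e: "e \<in> [{..<N}]\<^bsup>2\<^esup>" "c e \<notin> {i, j, l}"
      by blast
    from e(1) obtain x y where "e = {x, y}" "x \<in> {..<N}" "y \<in> {..<N}" "x \<noteq> y"
      by (rule nsets2_E)
    then show ?thesis
      using e(2) by blast
  qed
  show ?thesis
  proof (cases "N = 5")
    case True
    then obtain x p q where x: "{x, p, q} \<subseteq> {..<N}" "distinct [x, p, q]" "c {x, p} = c {x, q}"
      using P.ex_monochromatic_P3[OF _ many] by auto
    show ?thesis
    proof (rule embed_star[where x = x and D = "{p, q}" and m = "c {x, p}"])
      show star
        using True by (intro star_if_small) simp
      show "card support \<le> card {p, q} + 1"
        using card_support_le_three[OF True] x(2) by simp
    qed (use x in auto)
  next
    case N: False
    then have six: "6 \<le> N"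
      using False by simp
    then have "P.near_monochromatic \<or> P.monochromatic_off_four \<or> (\<exists>m. P.dominant_color m)"
      using P.rainbow_P5_free_structure[OF _ many] by simp
    then show ?thesis
    proof (elim disjE exE)
      assume P.near_monochromatic
      then show ?thesis
        unfolding P.near_monochromatic_def using monochromatic_if_near[OF six, of _ _ _ c] by metis
    next
      assume P.monochromatic_off_four
      then obtain p q r s m where "distinct [p, q, r, s]"
        and "\<And>x y. x < N \<Longrightarrow> y < N \<Longrightarrow> x \<noteq> y \<Longrightarrow> \<not> {x, y} \<subseteq> {p, q, r, s} \<Longrightarrow> c {x, y} = m"
        unfolding P.monochromatic_off_four_def by (metis lessThan_iff)
      then show ?thesis
        using six by (intro monochromatic_if_off_four) auto
    next
      fix m
      assume "P.dominant_color m"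
      then show ?thesis
        unfolding P.dominant_color_def by (intro monochromatic_if_dominant[of c m]) simp
    qed
  qed
qed

theorem theorem1p4:
  fixes H :: "'a graph"
  assumes "finite_graph H" and "edges H \<noteq> {}"
  shows "constrained_ramsey H (path_graph 5) \<le> ramsey_number (chromatic_number H + 1) H"
proof -
  have "finite (verts H)"
    using assms(1) unfolding finite_graph_def by simp
  then obtain \<kappa>0 where \<kappa>0: "bij_betw \<kappa>0 (verts H) {0..<card (verts H)}"
    using ex_bij_betw_finite_nat by blast
  \<comment> \<open>A bijective numbering of the vertices is a proper colouring, so the
    \<open>LEAST\<close> in \<open>chromatic_number\<close> is attained.\<close>
  have "proper_vertex_coloring H (card (verts H)) \<kappa>0"
    unfolding proper_vertex_coloring_def
  proof (intro conjI ballI impI)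
    fix u v
    assume "u \<in> verts H" "v \<in> verts H" "{u, v} \<in> edges H"
    then have "{u, v} \<in> [verts H]\<^bsup>2\<^esup>"
      using assms(1) unfolding finite_graph_def by (meson subsetD)
    then have "u \<noteq> v"
      by simp
    then show "\<kappa>0 u \<noteq> \<kappa>0 v"
      using \<kappa>0 \<open>u \<in> verts H\<close> \<open>v \<in> verts H\<close> by (auto simp: bij_betw_def dest: inj_onD)
  next
    show "\<kappa>0 \<in> verts H \<rightarrow> {..<card (verts H)}"
      using bij_betwE[OF \<kappa>0] by simp
  qed
  then have "\<exists>\<kappa>. proper_vertex_coloring H (card (verts H)) \<kappa>"
    by (rule exI[of _ \<kappa>0])
  then have "\<exists>\<kappa>. proper_vertex_coloring H (chromatic_number H) \<kappa>"
    unfolding chromatic_number_def by (rule LeastI)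
  then obtain \<kappa> where \<kappa>: "proper_vertex_coloring H (chromatic_number H) \<kappa>"
    by blast
  define N where "N = ramsey_number (chromatic_number H + 1) H"
  have "\<forall>c \<in> edges (complete_graph N) \<rightarrow> {1..chromatic_number H + 1}.
      \<exists>K. is_copy_in K H (complete_graph N) \<and> monochromatic_graph c K"
    unfolding N_def ramsey_number_def by (rule LeastI_ex[OF ex_ramsey_bound[OF assms(1)]])
  then interpret ramsey_graph H N "chromatic_number H" \<kappa>
    using assms \<kappa> by unfold_locales simp_all
  show ?thesis
    unfolding N_def[symmetric] constrained_ramsey_def
    using contains_monochromatic_copy monochromatic_or_rainbow by (intro Least_le) blast
qed

end
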